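(* Let $l\equiv 1\pmod 3$ be a rational prime and write $l=\gamma\bar\gamma$ with $\gamma,\bar\gamma\in R$ primary primes. Write $\gamma=c+d\omega$ with $c,d\in\mathbb{Z}$, and put $C=6c-3d$, $D=d$. Then $g_\gamma(t)$ gives the slopes, modulo $q$, on which $F_q$ takes one of the values $1,\omega,\bar\omega$, and which value it is depends only on $q$ modulo $l$. Precisely: there is a function $\varepsilon:(\mathbb{Z}/l\mathbb{Z})^{\times}\to\{1,\omega,\bar\omega\}$ such that for every rational prime $q\ge 5$ with $q\ne l$, every prime $p\equiv 1\pmod 3$ with $p\neq q$, and all integers $L,M$ with $4p=L^2+27M^2$, one has $$F_q(L,M)=\varepsilon(q \bmod l)$$ if and only if $\frac{M}{L}\equiv g_\gamma(t)\pmod q$ for some integer $t$, i.e. if and only if there is an integer $t$ with $$(Dt^3-Ct^2-9Dt+C)\,L\equiv -(Ct^3+27Dt^2-9Ct-27D)\,M \pmod q .$$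
   Context: Let $\omega=e^{2\pi i/3}$ and $R=\mathbb{Z}[\omega]$. A rational prime is a positive prime of $\mathbb{Z}$. A prime element $\pi=a+b\omega\in R$ ($a,b\in\mathbb{Z}$) is called primary if $3\mid b$. If $p\equiv 1\pmod 3$ is a rational prime and $\pi\in R$ is a primary prime with $\pi\bar\pi=p$, the cubic residue character $\chi_\pi$ is defined on $R$ by $\chi_\pi(\alpha)=0$ if $\pi\mid\alpha$, and otherwise $\chi_\pi(\alpha)$ is the unique element of $\{1,\omega,\bar\omega\}$ with $\alpha^{(p-1)/3}\equiv\chi_\pi(\alpha)\pmod \pi$. If $L,M$ are integers with $4p=L^2+27M^2$ for a prime $p\equiv 1\pmod 3$, set $a=\tfrac12(L+3M)$, $b=3M$ (so $L=2a-b$, $M=b/3$); then $a,b$ are integers and $\pi=a+b\omega$ is a primary prime with $\pi\bar\pi=p$. For a rational prime $q$ define $F_q(L,M)=\chi_\pi(q)$. For $\gamma=c+d\omega\in R$, with $C=6c-3d$ and $D=d$, define the rational function $$g_\gamma(t)=-\frac{Dt^3-Ct^2-9Dt+C}{Ct^3+27Dt^2-9Ct-27D}.$$ The slope of $(L,M)$ modulo $q$ is $M/L \bmod q$, which may be infinite; congruences between slopes and values of $g_\gamma$ are understood in cross-multiplied form. *)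

theory Defs
  imports Complex_Main "HOL-Number_Theory.Number_Theory"
begin

text \<open>The ring \<open>R = \<int>[\<omega>]\<close> with \<open>\<omega> = exp (2 \<pi> \<i> / 3)\<close>, in coordinates:
  \<open>Eis a b\<close> is \<open>a + b \<omega>\<close>. The map \<open>eis_to_complex\<close> below is an injective ring
  homomorphism onto \<open>\<int>[\<omega>] \<subseteq> \<complex>\<close> commuting with complex conjugation.\<close>

datatype eisenstein = Eis (coord_one: int) (coord_omega: int)

lemma eisenstein_eq_iff:
  "x = y \<longleftrightarrow> coord_one x = coord_one y \<and> coord_omega x = coord_omega y"
  by (cases x; cases y) simp

instantiation eisenstein :: comm_ring_1
begin

definition "0 = Eis 0 0"
definition "1 = Eis 1 0"
definition "x + y = Eis (coord_one x + coord_one y) (coord_omega x + coord_omega y)"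
definition "- x = Eis (- coord_one x) (- coord_omega x)"
definition "x - y = Eis (coord_one x - coord_one y) (coord_omega x - coord_omega y)"
text \<open>The product is determined by \<open>\<omega>\<^sup>2 = - 1 - \<omega>\<close>.\<close>
definition "x * y =
  Eis (coord_one x * coord_one y - coord_omega x * coord_omega y)
      (coord_one x * coord_omega y + coord_omega x * coord_one y - coord_omega x * coord_omega y)"

instance
  by standard
    (simp_all add: eisenstein_eq_iff zero_eisenstein_def one_eisenstein_def plus_eisenstein_def
      uminus_eisenstein_def minus_eisenstein_def times_eisenstein_def algebra_simps)

end

definition eis_omega :: eisenstein where
  "eis_omega = Eis 0 1"

text \<open>Complex conjugation: \<open>cnj \<omega> = \<omega>\<^sup>2 = - 1 - \<omega>\<close>.\<close>

definition eis_cnj :: "eisenstein \<Rightarrow> eisenstein" where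
  "eis_cnj z = Eis (coord_one z - coord_omega z) (- coord_omega z)"

definition eis_to_complex :: "eisenstein \<Rightarrow> complex" where
  "eis_to_complex z = of_int (coord_one z) + of_int (coord_omega z) * cis (2 * pi / 3)"

lemma cis_2pi_3: "cis (2 * pi / 3) = Complex (- 1 / 2) (sqrt 3 / 2)"
  by (simp add: complex_eq_iff cos_120 sin_120)

lemma eis_to_complex_eq:
  "eis_to_complex z =
     Complex (of_int (coord_one z) - of_int (coord_omega z) / 2) (of_int (coord_omega z) * sqrt 3 / 2)"
  by (simp add: eis_to_complex_def cis_2pi_3 complex_eq_iff)

lemma eis_to_complex_hom:
  "eis_to_complex 0 = 0" "eis_to_complex 1 = 1"
  "eis_to_complex (x + y) = eis_to_complex x + eis_to_complex y"
  "eis_to_complex (x * y) = eis_to_complex x * eis_to_complex y"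
  by (simp_all add: eis_to_complex_eq complex_eq_iff zero_eisenstein_def one_eisenstein_def
      plus_eisenstein_def times_eisenstein_def field_simps)

lemma eis_to_complex_omega: "eis_to_complex eis_omega = exp (2 * pi * \<i> / 3)"
  by (simp add: eis_to_complex_def eis_omega_def cis_conv_exp mult.commute)

lemma eis_to_complex_cnj: "eis_to_complex (eis_cnj z) = cnj (eis_to_complex z)"
  by (simp add: eis_to_complex_eq complex_eq_iff eis_cnj_def)

lemma inj_eis_to_complex: "inj eis_to_complex"
  by (rule injI) (auto simp: eis_to_complex_eq eisenstein_eq_iff)

definition primary_prime :: "eisenstein \<Rightarrow> bool" where
  "primary_prime \<pi> \<longleftrightarrow> prime_elem \<pi> \<and> 3 dvd coord_omega \<pi>"

definition eis_norm :: "eisenstein \<Rightarrow> int" where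
  "eis_norm z = coord_one (z * eis_cnj z)"

lemma of_int_eisenstein: "of_int n = Eis n 0"
proof -
  have nat: "of_nat k = Eis (int k) 0" for k
    by (induction k) (simp_all add: zero_eisenstein_def one_eisenstein_def plus_eisenstein_def)
  show ?thesis
    by (cases n) (simp_all add: nat one_eisenstein_def uminus_eisenstein_def
        minus_eisenstein_def)
qed

lemma mult_eis_cnj: "z * eis_cnj z = of_int (eis_norm z)"
  by (simp add: eis_norm_def of_int_eisenstein times_eisenstein_def eis_cnj_def algebra_simps)

text \<open>The cubic residue character; only meaningful when \<open>\<pi>\<close> is a primary prime whose norm
  \<open>p = \<pi> * eis_cnj \<pi>\<close> is a rational prime congruent to \<open>1\<close> modulo \<open>3\<close>.\<close>

definition cubic_char :: "eisenstein \<Rightarrow> eisenstein \<Rightarrow> eisenstein" where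
  "cubic_char \<pi> \<alpha> =
     (if \<pi> dvd \<alpha> then 0
      else THE z. z \<in> {1, eis_omega, eis_cnj eis_omega} \<and>
                  \<pi> dvd \<alpha> ^ ((nat (eis_norm \<pi>) - 1) div 3) - z)"

text \<open>If \<open>4 p = L\<^sup>2 + 27 M\<^sup>2\<close> then \<open>L\<close> and \<open>M\<close> have the same parity, so the division
  by \<open>2\<close> is exact.\<close>

definition F :: "nat \<Rightarrow> int \<Rightarrow> int \<Rightarrow> eisenstein" where
  "F q L M = cubic_char (Eis ((L + 3 * M) div 2) (3 * M)) (of_nat q)"

text \<open>\<open>g\<^sub>\<gamma>(t) = - g_num \<gamma> t / g_den \<gamma> t\<close>, where \<open>C = 6 c - 3 d\<close> and \<open>D = d\<close>
  for \<open>\<gamma> = c + d \<omega>\<close>.\<close>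

definition g_num :: "eisenstein \<Rightarrow> int \<Rightarrow> int" where
  "g_num \<gamma> t =
     (let C = 6 * coord_one \<gamma> - 3 * coord_omega \<gamma>; D = coord_omega \<gamma>
      in D * t ^ 3 - C * t ^ 2 - 9 * D * t + C)"

definition g_den :: "eisenstein \<Rightarrow> int \<Rightarrow> int" where
  "g_den \<gamma> t =
     (let C = 6 * coord_one \<gamma> - 3 * coord_omega \<gamma>; D = coord_omega \<gamma>
      in C * t ^ 3 + 27 * D * t ^ 2 - 9 * C * t - 27 * D)"

text \<open>The slope congruence \<open>M / L \<equiv> g\<^sub>\<gamma>(t) (mod q)\<close> in cross-multiplied form, so that
  infinite slopes are covered.\<close>

definition slope_cong_g :: "nat \<Rightarrow> eisenstein \<Rightarrow> int \<Rightarrow> int \<Rightarrow> int \<Rightarrow> bool" where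
  "slope_cong_g q \<gamma> t L M \<longleftrightarrow> [g_num \<gamma> t * L = - g_den \<gamma> t * M] (mod int q)"

end

theory Submission
  imports Defs "HOL-Computational_Algebra.Polynomial"
begin

text \<open>With \<open>\<surd>-3 = 1 + 2 \<omega>\<close> one has \<open>2 \<pi> = L + 3 M \<surd>-3\<close> and \<open>6 \<gamma> = C + 3 D \<surd>-3\<close>, and the
  congruence for the slope says that \<open>\<pi> \<gamma>\<close> is modulo \<open>q\<close> an integer multiple of the cube of
  \<open>t + \<surd>-3\<close>. The units of \<open>R / q\<close> modulo those of \<open>\<int> / q\<close> form a group of order \<open>q \<mp> 1\<close>, and
  being a cube there is decided by the power with exponent \<open>(q \<mp> 1) / 3\<close>. Cubic reciprocity
  for the rational prime \<open>q\<close> turns this condition into \<open>\<chi>\<^sub>\<pi>(q) \<chi>\<^sub>\<gamma>(q) = 1\<close>, so \<open>\<epsilon>\<close> is the conjugate of \<open>\<chi>\<^sub>\<gamma>\<close>.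

  Reciprocity itself comes from the \<open>q\<close>-th power of a Gauss sum, which is computed once by
  \<open>G\<^sup>3 = p J\<close> with the Jacobi sum \<open>J = \<plusminus>\<pi>\<close> and once by the Frobenius map modulo \<open>q\<close>. To stay
  inside polynomial rings, Gauss sums are elements of \<open>R[x]\<close> modulo \<open>x\<^sup>p - 1\<close>; there \<open>G\<^sup>3\<close> is
  \<open>p J\<close> only up to a multiple of \<open>1 + x + \<dots> + x\<^sup>p\<^sup>-\<^sup>1\<close>, which is annihilated by \<open>G\<close>.\<close>

section \<open>Congruences in commutative rings\<close>

lemma dvd_diff_mult:
  fixes d :: "'a::comm_ring_1"
  assumes "d dvd a - b" "d dvd a' - b'"
  shows "d dvd a * a' - b * b'"
proof -
  have "a * a' - b * b' = (a - b) * a' + b * (a' - b')" by (simp add: algebra_simps)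
  then show ?thesis using assms by simp
qed

lemma dvd_diff_power:
  fixes d :: "'a::comm_ring_1"
  assumes "d dvd a - b"
  shows "d dvd a ^ n - b ^ n"
  by (induction n) (auto intro: dvd_diff_mult assms)

lemma dvd_diff_add:
  fixes d :: "'a::comm_ring_1"
  assumes "d dvd a - b" "d dvd a' - b'"
  shows "d dvd (a + a') - (b + b')"
proof -
  have "(a + a') - (b + b') = (a - b) + (a' - b')" by simp
  then show ?thesis using assms by (metis dvd_add)
qed

lemma dvd_diff_sum:
  fixes d :: "'a::comm_ring_1"
  assumes "\<And>i. i \<in> I \<Longrightarrow> d dvd f i - g i"
  shows "d dvd sum f I - sum g I"
  unfolding sum_subtractf[symmetric] by (rule dvd_sum) (use assms in auto)

lemma dvd_diff_trans:
  fixes d :: "'a::comm_ring_1"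
  assumes "d dvd a - b" "d dvd b - c"
  shows "d dvd a - c"
  using dvd_add[OF assms] by simp

lemma dvd_diff_sym:
  fixes d :: "'a::comm_ring_1"
  shows "d dvd a - b \<Longrightarrow> d dvd b - a"
  by (metis dvd_minus_iff minus_diff_eq)

lemma frobenius_add:
  fixes a b :: "'a::comm_ring_1"
  assumes "prime q"
  shows "of_nat q dvd (a + b) ^ q - (a ^ q + b ^ q)"
proof -
  have q: "q > 0" using assms prime_gt_0_nat by blast
  have "(a + b) ^ q = (\<Sum>k\<le>q. of_nat (q choose k) * a ^ k * b ^ (q - k))"
    by (rule binomial_ring)
  also have "{..q} = insert 0 (insert q {1..<q})" using q by auto
  also have "(\<Sum>k\<in>\<dots>. of_nat (q choose k) * a ^ k * b ^ (q - k))
      = b ^ q + (a ^ q + (\<Sum>k\<in>{1..<q}. of_nat (q choose k) * a ^ k * b ^ (q - k)))"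
    using q by (subst sum.insert; auto)
  finally have "(a + b) ^ q - (a ^ q + b ^ q)
      = (\<Sum>k\<in>{1..<q}. of_nat (q choose k) * a ^ k * b ^ (q - k))" by simp
  moreover have "of_nat q dvd (\<Sum>k\<in>{1..<q}. of_nat (q choose k) * a ^ k * b ^ (q - k))"
  proof (rule dvd_sum)
    fix k assume "k \<in> {1..<q}"
    then have "q dvd q choose k" using assms by (intro dvd_choose_prime) auto
    then have "(of_nat q :: 'a) dvd of_nat (q choose k)" by (metis dvd_def of_nat_mult)
    then show "of_nat q dvd of_nat (q choose k) * a ^ k * b ^ (q - k)"
      by (metis dvd_mult2)
  qed
  ultimately show ?thesis by metis
qed

lemma frobenius_sum:
  fixes f :: "'b \<Rightarrow> 'a::comm_ring_1"
  assumes "prime q" "finite I"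
  shows "of_nat q dvd (\<Sum>i\<in>I. f i) ^ q - (\<Sum>i\<in>I. f i ^ q)"
  using assms(2)
proof (induction I)
  case empty
  then show ?case using assms prime_gt_0_nat[of q] by (simp add: power_0_left)
next
  case (insert x I)
  have "of_nat q dvd (f x + sum f I) ^ q - (f x ^ q + sum f I ^ q)"
    by (rule frobenius_add[OF assms(1)])
  moreover have "of_nat q dvd (f x ^ q + sum f I ^ q) - (f x ^ q + (\<Sum>i\<in>I. f i ^ q))"
    using insert.IH by simp
  ultimately show ?case using insert.hyps by (simp, metis dvd_diff_trans)
qed

lemma card_roots_mod_prime_le:
  fixes f :: "int poly"
  assumes "prime q" "\<not> int q dvd coeff f i" "degree f \<le> n"
  shows "card {x \<in> {0..<int q}. int q dvd poly f x} \<le> n"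
  using assms(2,3)
proof (induction n arbitrary: f i)
  case 0
  then have "f = [:coeff f 0:]" by (metis bot_nat_0.extremum_uniqueI degree_0_id)
  moreover have "\<not> int q dvd coeff f 0"
    using 0 by (metis coeff_eq_0 dvd_0_right le_0_eq neq0_conv)
  ultimately have "{x \<in> {0..<int q}. int q dvd poly f x} = {}"
    by (metis (no_types, lifting) Collect_empty_eq add.right_neutral mult_zero_right poly_0 poly_pCons)
  then show ?case by (simp only: card.empty)
next
  case (Suc n)
  let ?R = "\<lambda>f. {x \<in> {0..<int q}. int q dvd poly f x}"
  have pr: "prime (int q)" using assms(1) by simp
  show ?case
  proof (cases "?R f = {}")
    case False
    then obtain a where a: "a \<in> {0..<int q}" "int q dvd poly f a" by auto
    define g where "g = synthetic_div f a"
    have fg: "f = [:-a, 1:] * g + [:poly f a:]"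
      unfolding g_def using synthetic_div_correct'[of a f] by simp
    have "\<exists>j. \<not> int q dvd coeff g j"
    proof (rule ccontr)
      assume "\<nexists>j. \<not> int q dvd coeff g j"
      then have g: "[:int q:] dvd g" by (simp add: const_poly_dvd_iff)
      have "[:int q:] dvd f"
        by (subst fg, rule dvd_add[OF dvd_mult[OF g]]) (use a in \<open>simp add: const_poly_dvd_iff_dvd_content\<close>)
      then show False using Suc.prems by (simp add: const_poly_dvd_iff)
    qed
    then obtain j where j: "\<not> int q dvd coeff g j" by blast
    have "degree g \<le> n" using Suc.prems by (simp add: g_def degree_synthetic_div)
    then have IH: "card (?R g) \<le> n" using Suc.IH[OF j] by simp
    have "?R f \<subseteq> insert a (?R g)"
    proof
      fix x assume x: "x \<in> ?R f"
      have "poly f x = (x - a) * poly g x + poly f a" by (subst fg) (simp add: algebra_simps)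
      then have "int q dvd (x - a) * poly g x"
        using x a by (metis (no_types, lifting) dvd_add_left_iff mem_Collect_eq)
      then consider "int q dvd x - a" | "int q dvd poly g x"
        using pr prime_dvd_mult_iff by blast
      then show "x \<in> insert a (?R g)"
      proof cases
        case 1
        then have "x = a" using a x by (auto simp: mod_eq_dvd_iff[symmetric])
        then show ?thesis by simp
      qed (use x in auto)
    qed
    then have "card (?R f) \<le> card (insert a (?R g))" by (intro card_mono) (auto intro: finite_subset[of _ "{0..<int q}"])
    also have "\<dots> \<le> Suc n"
      using IH finite_subset[of "?R g" "{0..<int q}"] by (subst card_insert_if) force+
    finally show ?thesis .
  next
    case True then show ?thesis by (simp only: card.empty)
  qed
qed

section \<open>Eisenstein integers\<close>

lemmas eis_simps = eisenstein_eq_iff zero_eisenstein_def one_eisenstein_def plus_eisenstein_def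
  uminus_eisenstein_def minus_eisenstein_def times_eisenstein_def of_int_eisenstein
  eis_cnj_def eis_omega_def

lemma of_nat_eisenstein: "of_nat n = Eis (int n) 0"
  using of_int_eisenstein[of "int n"] by simp

lemma eis_norm_eq:
  "eis_norm z = coord_one z ^ 2 - coord_one z * coord_omega z + coord_omega z ^ 2"
  by (simp add: eis_norm_def eis_simps power2_eq_square algebra_simps)

lemma eis_norm_mult: "eis_norm (x * y) = eis_norm x * eis_norm y"
  by (simp add: eis_norm_eq eis_simps power2_eq_square algebra_simps)

lemma eis_norm_cnj: "eis_norm (eis_cnj x) = eis_norm x"
  by (simp add: eis_norm_eq eis_simps power2_eq_square algebra_simps)

lemma eis_norm_of_int: "eis_norm (of_int n) = n ^ 2"
  by (simp add: eis_norm_eq eis_simps)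

lemma eis_norm_eq_0_iff: "eis_norm z = 0 \<longleftrightarrow> z = 0"
proof
  assume "eis_norm z = 0"
  then have "(2 * coord_one z - coord_omega z)\<^sup>2 + 3 * (coord_omega z)\<^sup>2 = 0"
    by (simp add: eis_norm_eq power2_eq_square algebra_simps)
  then have "3 * (coord_omega z)\<^sup>2 = 0" "(2 * coord_one z - coord_omega z)\<^sup>2 = 0"
    using zero_le_power2[of "2 * coord_one z - coord_omega z"] zero_le_power2[of "coord_omega z"]
    by linarith+
  then show "z = 0" by (simp add: eis_simps)
qed (simp add: eis_norm_eq eis_simps)

instance eisenstein :: idom
proof
  fix a b :: eisenstein
  assume "a \<noteq> 0" "b \<noteq> 0"
  then show "a * b \<noteq> 0"
    by (metis eis_norm_eq_0_iff eis_norm_mult mult_eq_0_iff)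
qed

lemma eis_cnj_add: "eis_cnj (x + y) = eis_cnj x + eis_cnj y"
  and eis_cnj_mult: "eis_cnj (x * y) = eis_cnj x * eis_cnj y"
  and eis_cnj_diff: "eis_cnj (x - y) = eis_cnj x - eis_cnj y"
  and eis_cnj_cnj [simp]: "eis_cnj (eis_cnj x) = x"
  and eis_cnj_of_int [simp]: "eis_cnj (of_int n) = of_int n"
  and eis_cnj_0 [simp]: "eis_cnj 0 = 0"
  and eis_cnj_1 [simp]: "eis_cnj 1 = 1"
  by (simp_all add: eis_simps algebra_simps)

lemma eis_cnj_of_nat [simp]: "eis_cnj (of_nat n) = of_nat n"
  using eis_cnj_of_int[of "int n"] by simp

lemma eis_cnj_power: "eis_cnj (x ^ n) = eis_cnj x ^ n"
  by (induction n) (simp_all add: eis_cnj_mult)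

lemma eis_cnj_sum: "eis_cnj (sum f I) = (\<Sum>i\<in>I. eis_cnj (f i))"
  by (induction I rule: infinite_finite_induct) (simp_all add: eis_cnj_add)

lemma of_int_dvd_eis_iff: "of_int n dvd z \<longleftrightarrow> n dvd coord_one z \<and> n dvd coord_omega z"
proof
  assume "n dvd coord_one z \<and> n dvd coord_omega z"
  then obtain u v where "coord_one z = n * u" "coord_omega z = n * v" by (auto elim!: dvdE)
  then have "z = of_int n * Eis u v" by (simp add: eis_simps)
  then show "of_int n dvd z" by simp
qed (auto elim!: dvdE simp: eis_simps)

lemma of_nat_dvd_eis_iff:
  "of_nat n dvd z \<longleftrightarrow> int n dvd coord_one z \<and> int n dvd coord_omega z"
  using of_int_dvd_eis_iff[of "int n"] by simp

lemma eis_cnj_dvd: "x dvd y \<Longrightarrow> eis_cnj x dvd eis_cnj y"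
  by (auto elim!: dvdE simp: eis_cnj_mult)

lemma eis_omega_cube: "eis_omega ^ 3 = 1"
  by (simp add: eis_simps eval_nat_numeral)

definition cube_units :: "eisenstein set" where
  "cube_units = {1, eis_omega, eis_cnj eis_omega}"

lemma cube_units_cube: "z \<in> cube_units \<Longrightarrow> z ^ 3 = 1"
  by (auto simp: cube_units_def eis_simps eval_nat_numeral)

lemma cube_units_cnj: "z \<in> cube_units \<Longrightarrow> eis_cnj z \<in> cube_units"
  by (auto simp: cube_units_def)

lemma cube_units_mult: "z \<in> cube_units \<Longrightarrow> w \<in> cube_units \<Longrightarrow> z * w \<in> cube_units"
  by (auto simp: cube_units_def eis_simps)

lemma cube_units_square: "z \<in> cube_units \<Longrightarrow> z ^ 2 = eis_cnj z"
  by (auto simp: cube_units_def eis_simps eval_nat_numeral)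

lemma cube_units_mult_cnj: "z \<in> cube_units \<Longrightarrow> z * eis_cnj z = 1"
  by (auto simp: cube_units_def eis_simps)

lemma cube_units_norm_diff:
  "z \<in> cube_units \<Longrightarrow> w \<in> cube_units \<Longrightarrow> z \<noteq> w \<Longrightarrow> eis_norm (z - w) = 3"
  by (auto simp: cube_units_def eis_simps eis_norm_eq)

lemma dvd_cube_units_imp_eq:
  assumes "\<not> eis_norm d dvd 3" "d dvd z - w" "z \<in> cube_units" "w \<in> cube_units"
  shows "z = w"
  using assms cube_units_norm_diff eis_norm_mult by (metis dvd_def)

lemma frobenius_eis:
  fixes z :: eisenstein
  assumes "prime q" "q mod 3 = r"
  shows "of_nat q dvd z ^ q - (of_int (coord_one z) + of_int (coord_omega z) * eis_omega ^ r)"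
proof -
  have z: "z = of_int (coord_one z) + of_int (coord_omega z) * eis_omega"
    by (simp add: eis_simps)
  have om: "eis_omega ^ q = eis_omega ^ r"
    using assms(2) by (metis div_mult_mod_eq eis_omega_cube mult.commute mult_1 power_add power_mult power_one)
  have fermat: "of_nat q dvd (of_int n :: eisenstein) ^ q - of_int n" for n
  proof -
    have q: "q > 0" using assms(1) prime_gt_0_nat by blast
    have "[n ^ q = n] (mod int q)"
    proof (cases "int q dvd n")
      case True
      then show ?thesis using q dvd_trans[OF True dvd_power[of q n]]
        by (simp add: cong_iff_dvd_diff)
    next
      case False
      define k where "k = nat (n mod int q)"
      have k: "int k = n mod int q" using q by (simp add: k_def)
      then have "\<not> int q dvd int k" using False by (simp add: dvd_mod_iff)
      then have "[k ^ (q - 1) = 1] (mod q)" using fermat_theorem[OF assms(1)] by simp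
      then have "[int k ^ (q - 1) * int k = 1 * int k] (mod int q)"
        by (intro cong_scalar_right) (simp flip: cong_int_iff)
      then have "[int k ^ q = int k] (mod int q)" using q power_minus_mult[of q "int k"] by simp
      moreover have "[n = int k] (mod int q)" unfolding k by (simp add: cong_def)
      ultimately show ?thesis by (meson cong_pow cong_sym cong_trans)
    qed
    then have "int q dvd n ^ q - n" by (simp add: cong_iff_dvd_diff)
    then have "(of_int (int q) :: eisenstein) dvd of_int (n ^ q - n)"
      by (subst of_int_dvd_eis_iff) (simp only: of_int_eisenstein eisenstein.sel dvd_0_right)
    then show ?thesis by simp
  qed
  have "of_nat q dvd z ^ q - (of_int (coord_one z) ^ q + (of_int (coord_omega z) * eis_omega) ^ q)"
    by (subst (1) z, rule frobenius_add[OF assms(1)])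
  moreover have "of_nat q dvd (of_int (coord_one z) ^ q + (of_int (coord_omega z) * eis_omega) ^ q)
     - (of_int (coord_one z) + of_int (coord_omega z) * eis_omega ^ r)"
    unfolding power_mult_distrib om
    by (intro dvd_diff_add dvd_diff_mult fermat) simp
  ultimately show ?thesis by (rule dvd_diff_trans)
qed

lemma frobenius_eis_1:
  fixes z :: eisenstein
  assumes "prime q" "q mod 3 = 1"
  shows "of_nat q dvd z ^ q - z"
proof -
  have "of_int (coord_one z) + of_int (coord_omega z) * eis_omega ^ 1 = z"
    by (simp add: eis_simps)
  then show ?thesis using frobenius_eis[OF assms, of z] by metis
qed

lemma frobenius_eis_2:
  fixes z :: eisenstein
  assumes "prime q" "q mod 3 = 2"
  shows "of_nat q dvd z ^ q - eis_cnj z"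
proof -
  have "of_int (coord_one z) + of_int (coord_omega z) * eis_omega ^ 2 = eis_cnj z"
    by (simp add: eis_simps power2_eq_square)
  then show ?thesis using frobenius_eis[OF assms, of z] by metis
qed

section \<open>The cubic residue character\<close>

locale cubic_prime =
  fixes p :: nat and \<pi> :: eisenstein
  assumes prime_p: "prime p" and p_mod_3: "p mod 3 = 1" and norm_pi: "eis_norm \<pi> = int p"
    and omega_3: "3 dvd coord_omega \<pi>"
begin

definition m :: nat where "m = (p - 1) div 3"

lemma p_eq: "p = 3 * m + 1" and m_pos: "m > 0"
proof -
  show *: "p = 3 * m + 1" unfolding m_def using p_mod_3 by presburger
  show "m > 0" using * prime_p by (cases m) auto
qed

lemma p_ge: "p \<ge> 7"
proof -
  have "m \<noteq> 1" using p_eq prime_p by auto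
  then show ?thesis using p_eq m_pos by linarith
qed

lemma prime_int_p: "prime (int p)" using prime_p by simp

lemma pi_dvd_p: "\<pi> dvd of_nat p"
  using mult_eis_cnj[of \<pi>] norm_pi by (metis dvd_triv_left of_int_of_nat_eq)

lemma residue_exists: "\<exists>r. \<pi> dvd eis_omega - of_int r"
proof -
  obtain a b where ab: "\<pi> = Eis a b" by (cases \<pi>)
  have n: "a ^ 2 - a * b + b ^ 2 = int p" using norm_pi by (simp add: eis_norm_eq ab)
  have "\<not> int p dvd b"
  proof
    assume b: "int p dvd b"
    have "a ^ 2 = int p + a * b - b ^ 2" using n by simp
    then have "int p dvd a ^ 2" using b by (simp add: power2_eq_square)
    then have "int p dvd a" using prime_int_p prime_dvd_power by blast
    then have "int p ^ 2 dvd a ^ 2 - a * b + b ^ 2" using b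
      by (simp add: power2_eq_square mult_dvd_mono)
    then show False using n p_ge by (auto simp: power2_eq_square dest: zdvd_imp_le)
  qed
  then have "coprime b (int p)" using prime_int_p
    by (metis coprime_commute prime_imp_coprime)
  then obtain c where c: "[b * c = 1] (mod int p)" using cong_solve_coprime_int by blast
  then obtain k where k: "b * c = 1 + int p * k" by (metis cong_iff_lin cong_sym)
  have "eis_omega - of_int (- a * c) = of_int c * \<pi> - of_nat p * (of_int k * eis_omega)"
    using k by (simp add: eis_simps ab of_nat_eisenstein algebra_simps)
  moreover have "\<pi> dvd of_int c * \<pi> - of_nat p * (of_int k * eis_omega)"
    using pi_dvd_p by simp
  ultimately show ?thesis by metis
qed

definition omega_res :: int where "omega_res = (SOME omega_res. \<pi> dvd eis_omega - of_int omega_res)"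

lemma pi_dvd_omega_res: "\<pi> dvd eis_omega - of_int omega_res"
  unfolding omega_res_def using residue_exists by (rule someI_ex)

lemma pi_dvd_int_iff: "\<pi> dvd of_int n \<longleftrightarrow> int p dvd n"
proof
  assume "\<pi> dvd of_int n"
  then have "eis_norm \<pi> dvd eis_norm (of_int n)" by (auto elim!: dvdE simp: eis_norm_mult)
  then show "int p dvd n"
    unfolding norm_pi eis_norm_of_int using prime_int_p prime_dvd_power by blast
next
  assume "int p dvd n"
  then obtain k where "n = int p * k" by (rule dvdE)
  then have "of_int n = of_nat p * (of_int k :: eisenstein)" by simp
  then show "\<pi> dvd of_int n" using pi_dvd_p by (metis dvd_mult2)
qed

lemma pi_dvd_iff: "\<pi> dvd z \<longleftrightarrow> int p dvd coord_one z + coord_omega z * omega_res"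
proof -
  have z: "z = of_int (coord_one z + coord_omega z * omega_res) + of_int (coord_omega z) * (eis_omega - of_int omega_res)"
    by (simp add: eis_simps)
  have "\<pi> dvd of_int (coord_omega z) * (eis_omega - of_int omega_res)" using pi_dvd_omega_res by simp
  then have "\<pi> dvd z \<longleftrightarrow> \<pi> dvd of_int (coord_one z + coord_omega z * omega_res)"
    by (subst z) (simp add: dvd_add_left_iff del: of_int_add of_int_mult)
  then show ?thesis by (simp only: pi_dvd_int_iff)
qed

lemma prime_elem_pi: "prime_elem \<pi>"
proof (rule prime_elemI)
  show "\<pi> \<noteq> 0" using norm_pi p_ge by (auto simp: eis_norm_eq eis_simps)
  show "\<not> \<pi> dvd 1" using pi_dvd_int_iff[of 1] prime_p by (simp add: prime_nat_iff)
  fix a b assume ab: "\<pi> dvd a * b"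
  let ?h = "\<lambda>z :: eisenstein. of_int (coord_one z + coord_omega z * omega_res) :: eisenstein"
  have h: "\<pi> dvd z - ?h z" for z
  proof -
    have "z - ?h z = of_int (coord_omega z) * (eis_omega - of_int omega_res)" by (simp add: eis_simps)
    then show ?thesis using pi_dvd_omega_res by simp
  qed
  have "\<pi> dvd ?h a * ?h b"
    using dvd_diff_mult[OF h h, of a b] ab by (metis dvd_diff_right_iff)
  then have "int p dvd (coord_one a + coord_omega a * omega_res) * (coord_one b + coord_omega b * omega_res)"
    by (simp only: pi_dvd_int_iff flip: of_int_mult)
  then show "\<pi> dvd a \<or> \<pi> dvd b"
    unfolding pi_dvd_iff using prime_int_p prime_dvd_mult_iff by blast
qed

lemma pi_not_dvd_3: "\<not> eis_norm \<pi> dvd 3"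
  unfolding norm_pi using p_ge by (auto dest: zdvd_imp_le)

lemma pi_dvd_cubic_poly:
  assumes "\<not> \<pi> dvd z"
  shows "\<exists>w\<in>cube_units. \<pi> dvd z ^ m - w"
proof -
  have "\<pi> dvd z ^ p - z"
    using frobenius_eis_1[OF prime_p p_mod_3] pi_dvd_p by (rule dvd_trans[rotated])
  also have "z ^ p - z = z * ((z ^ m - 1) * ((z ^ m - eis_omega) * (z ^ m - eis_cnj eis_omega)))"
  proof -
    have "(x - 1) * ((x - eis_omega) * (x - eis_cnj eis_omega)) = x ^ 3 - 1" for x :: eisenstein
      by (simp add: eis_simps eval_nat_numeral algebra_simps)
    moreover have "z ^ p = z * (z ^ m) ^ 3"
    proof -
      have "z ^ (3 * m + 1) = z * (z ^ m) ^ 3" by (simp add: mult.commute flip: power_mult)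
      then show ?thesis by (simp only: p_eq[symmetric])
    qed
    ultimately show ?thesis by (simp only: right_diff_distrib mult_1_right)
  qed
  finally show ?thesis using assms prime_elem_pi
    by (auto simp: prime_elem_dvd_mult_iff cube_units_def)
qed

lemma cubic_char_eqI:
  assumes "\<not> \<pi> dvd z" "w \<in> cube_units" "\<pi> dvd z ^ m - w"
  shows "cubic_char \<pi> z = w"
proof -
  have "(nat (eis_norm \<pi>) - 1) div 3 = m" by (simp add: norm_pi m_def)
  then have "cubic_char \<pi> z = (THE w. w \<in> cube_units \<and> \<pi> dvd z ^ m - w)"
    using assms(1) by (simp add: cubic_char_def cube_units_def)
  also have "\<dots> = w"
  proof (rule the_equality)
    fix w' assume w': "w' \<in> cube_units \<and> \<pi> dvd z ^ m - w'"
    then have "\<pi> dvd w' - w" using assms(3) by (meson dvd_diff_sym dvd_diff_trans)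
    then show "w' = w" using dvd_cube_units_imp_eq[OF pi_not_dvd_3] w' assms(2) by blast
  qed (use assms in simp)
  finally show ?thesis .
qed

definition \<chi> :: "int \<Rightarrow> eisenstein" where "\<chi> n = cubic_char \<pi> (of_int n)"

lemma chi_0: "int p dvd n \<Longrightarrow> \<chi> n = 0"
  by (simp add: \<chi>_def cubic_char_def pi_dvd_int_iff)

lemma chi_cases:
  assumes "\<not> int p dvd n"
  shows "\<chi> n \<in> cube_units" "\<pi> dvd of_int n ^ m - \<chi> n"
proof -
  have *: "\<not> \<pi> dvd of_int n" using assms by (simp add: pi_dvd_int_iff)
  then obtain w where w: "w \<in> cube_units" "\<pi> dvd of_int n ^ m - w"
    using pi_dvd_cubic_poly by blast
  then have "\<chi> n = w" unfolding \<chi>_def using cubic_char_eqI * by blast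
  then show "\<chi> n \<in> cube_units" "\<pi> dvd of_int n ^ m - \<chi> n" using w by auto
qed

lemma chi_cong: "\<pi> dvd of_int n ^ m - \<chi> n"
proof (cases "int p dvd n")
  case True
  then have "\<pi> dvd of_int n ^ m"
    using m_pos dvd_trans[of \<pi> "of_int n" "of_int n ^ m"] dvd_power[of m "of_int n :: eisenstein"]
    by (simp add: pi_dvd_int_iff)
  then show ?thesis using True by (simp add: chi_0)
qed (rule chi_cases)

lemma chi_eqI:
  assumes "\<not> int p dvd n" "w \<in> cube_units" "\<pi> dvd of_int n ^ m - w"
  shows "\<chi> n = w"
  unfolding \<chi>_def using assms by (intro cubic_char_eqI) (auto simp: pi_dvd_int_iff)

lemma chi_mult: "\<chi> (a * b) = \<chi> a * \<chi> b"
proof (cases "int p dvd a * b")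
  case True
  then have "int p dvd a \<or> int p dvd b" using prime_int_p prime_dvd_mult_iff by blast
  then show ?thesis using True by (auto simp: chi_0)
next
  case False
  then have ab: "\<not> int p dvd a" "\<not> int p dvd b" by auto
  show ?thesis
  proof (rule chi_eqI[OF False])
    show "\<chi> a * \<chi> b \<in> cube_units" using ab chi_cases cube_units_mult by blast
    show "\<pi> dvd of_int (a * b) ^ m - \<chi> a * \<chi> b"
      unfolding of_int_mult power_mult_distrib by (intro dvd_diff_mult chi_cong)
  qed
qed

lemma chi_mod_cong:
  assumes "[a = b] (mod int p)"
  shows "\<chi> a = \<chi> b"
proof (cases "int p dvd a")
  case True
  then have "int p dvd b" using cong_dvd_iff[OF assms] by simp
  then show ?thesis using True by (simp add: chi_0)
next
  case False
  then have b: "\<not> int p dvd b" using cong_dvd_iff[OF assms] by simp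
  have "\<pi> dvd of_int (a - b)"
    using assms by (simp only: cong_iff_dvd_diff pi_dvd_int_iff)
  then have "\<pi> dvd of_int a - of_int b" by simp
  then have "\<pi> dvd of_int a ^ m - of_int b ^ m" by (rule dvd_diff_power)
  then have "\<pi> dvd of_int a ^ m - \<chi> b" using chi_cong dvd_diff_trans by blast
  then show ?thesis using False chi_cases(1)[OF b] chi_eqI by blast
qed

lemma chi_1: "\<chi> 1 = 1"
  by (rule chi_eqI) (use prime_p in \<open>auto simp: cube_units_def prime_nat_iff\<close>)

lemma chi_cube: "\<not> int p dvd n \<Longrightarrow> \<chi> n ^ 3 = 1"
  using chi_cases cube_units_cube by blast

lemma chi_power: "\<chi> (n ^ k) = \<chi> n ^ k"
  by (induction k) (simp_all add: chi_1 chi_mult)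

lemma chi_minus: "\<chi> (- n) = \<chi> n"
proof -
  have "\<not> int p dvd - 1" using prime_p by (auto simp: prime_nat_iff)
  then have "\<chi> (- 1) = 1" using chi_cube[of "-1"] chi_power[of "-1" 3] by simp
  then show ?thesis using chi_mult[of "-1" n] by simp
qed

lemma nontrivial_exists: 
  assumes "0 < k" "k < p - 1"
  shows "\<exists>g. \<not> int p dvd g \<and> \<not> [g ^ k = 1] (mod int p)"
proof (rule ccontr)
  assume "\<not> ?thesis"
  then have g: "int p dvd g ^ k - 1" if "\<not> int p dvd g" for g
    using that by (auto simp: cong_iff_dvd_diff)
  let ?f = "monom 1 k - 1 :: int poly"
  have "{1..<int p} \<subseteq> {x \<in> {0..<int p}. int p dvd poly ?f x}"
    using g zdvd_not_zless by (force simp: poly_monom)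
  then have "card {1..<int p} \<le> card {x \<in> {0..<int p}. int p dvd poly ?f x}"
    by (intro card_mono) (auto intro: finite_subset[of _ "{0..<int p}"])
  also have "\<dots> \<le> k"
  proof (rule card_roots_mod_prime_le[OF prime_p])
    show "\<not> int p dvd coeff ?f k" using assms prime_p by (auto simp: prime_nat_iff)
    show "degree ?f \<le> k" by (intro degree_diff_le) (auto simp: degree_monom_le)
  qed
  finally show False using assms by simp
qed

lemma chi_nontrivial: "\<exists>g. \<not> int p dvd g \<and> \<chi> g \<noteq> 1"
proof -
  have "m < p - 1" using p_eq m_pos by linarith
  then obtain g where g: "\<not> int p dvd g" "\<not> [g ^ m = 1] (mod int p)"
    using nontrivial_exists[of m] m_pos by blast
  have "\<chi> g \<noteq> 1"
  proof
    assume "\<chi> g = 1"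
    then have "\<pi> dvd of_int (g ^ m - 1)" using chi_cong[of g] by simp
    then show False using g unfolding pi_dvd_int_iff cong_iff_dvd_diff by blast
  qed
  then show ?thesis using g by blast
qed

end

section \<open>Convolutions and Jacobi sums\<close>

lemma bij_betw_mult_mod:
  assumes "prime p" "\<not> int p dvd a"
  shows "bij_betw (\<lambda>i. (a * i) mod int p) {0..<int p} {0..<int p}"
proof -
  have p: "p > 0" using assms(1) prime_gt_0_nat by blast
  have pr: "prime (int p)" using assms(1) by simp
  have "inj_on (\<lambda>i. (a * i) mod int p) {0..<int p}"
  proof (rule inj_onI)
    fix x y assume xy: "x \<in> {0..<int p}" "y \<in> {0..<int p}" "(a * x) mod int p = (a * y) mod int p"
    then have "int p dvd a * (x - y)" by (simp add: mod_eq_dvd_iff right_diff_distrib)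
    then have "int p dvd x - y" using pr assms(2) prime_dvd_mult_iff by blast
    then show "x = y" using xy by (simp add: mod_eq_dvd_iff[symmetric])
  qed
  moreover have "(\<lambda>i. (a * i) mod int p) ` {0..<int p} \<subseteq> {0..<int p}" using p by auto
  ultimately show ?thesis
    by (simp add: bij_betw_def endo_inj_surj)
qed

lemma bij_betw_diff_mod:
  assumes "p > (0::int)"
  shows "bij_betw (\<lambda>i. (s - i) mod p) {0..<p} {0..<p}"
proof (rule bij_betw_byWitness[where f' = "\<lambda>i. (s - i) mod p"])
  show "\<forall>a\<in>{0..<p}. (s - (s - a) mod p) mod p = a"
    by (auto simp: mod_diff_right_eq)
qed (use assms in \<open>auto simp: mod_diff_right_eq\<close>)

definition periodic :: "nat \<Rightarrow> (int \<Rightarrow> 'a) \<Rightarrow> bool" where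
  "periodic p f \<longleftrightarrow> (\<forall>a b. [a = b] (mod int p) \<longrightarrow> f a = f b)"

lemma periodicD: "periodic p f \<Longrightarrow> [a = b] (mod int p) \<Longrightarrow> f a = f b"
  by (auto simp: periodic_def)

lemma periodic_mod: "periodic p f \<Longrightarrow> f (a mod int p) = f a"
  by (auto intro: periodicD simp: cong_def)

lemma sum_mult_periodic:
  fixes f :: "int \<Rightarrow> 'a::comm_monoid_add"
  assumes "prime p" "\<not> int p dvd a" "periodic p f"
  shows "(\<Sum>i\<in>{0..<int p}. f (a * i)) = (\<Sum>i\<in>{0..<int p}. f i)"
proof -
  have "(\<Sum>i\<in>{0..<int p}. f ((a * i) mod int p)) = (\<Sum>i\<in>{0..<int p}. f i)"
    by (rule sum.reindex_bij_betw[OF bij_betw_mult_mod[OF assms(1,2)]])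
  then show ?thesis by (simp add: periodic_mod[OF assms(3)])
qed

lemma sum_diff_periodic:
  fixes f :: "int \<Rightarrow> 'a::comm_monoid_add"
  assumes "p > 0" "periodic p f"
  shows "(\<Sum>i\<in>{0..<int p}. f (s - i)) = (\<Sum>i\<in>{0..<int p}. f i)"
proof -
  have "(\<Sum>i\<in>{0..<int p}. f ((s - i) mod int p)) = (\<Sum>i\<in>{0..<int p}. f i)"
    by (rule sum.reindex_bij_betw[OF bij_betw_diff_mod]) (use assms in simp)
  then show ?thesis by (simp add: periodic_mod[OF assms(2)])
qed

definition conv :: "nat \<Rightarrow> (int \<Rightarrow> 'a) \<Rightarrow> (int \<Rightarrow> 'a) \<Rightarrow> int \<Rightarrow> 'a::comm_ring_1" where
  "conv p f g s = (\<Sum>i\<in>{0..<int p}. f i * g (s - i))"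

lemma sum_conv:
  assumes "p > 0" "periodic p g"
  shows "(\<Sum>s\<in>{0..<int p}. conv p f g s) = (\<Sum>i\<in>{0..<int p}. f i) * (\<Sum>i\<in>{0..<int p}. g i)"
proof -
  have shift: "(\<Sum>s\<in>{0..<int p}. g (s - i)) = (\<Sum>s\<in>{0..<int p}. g s)" for i
  proof -
    have per: "periodic p (\<lambda>s. g (- s))"
      using assms(2) by (auto simp: periodic_def cong_minus_minus_iff)
    have "(\<Sum>s\<in>{0..<int p}. g (s - i)) = (\<Sum>s\<in>{0..<int p}. g (- (i - s)))" by simp
    also have "\<dots> = (\<Sum>s\<in>{0..<int p}. g (- s))" by (rule sum_diff_periodic[OF assms(1) per])
    also have "\<dots> = (\<Sum>s\<in>{0..<int p}. g s)" using sum_diff_periodic[OF assms, of 0] by simp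
    finally show ?thesis .
  qed
  show ?thesis
    unfolding conv_def by (subst sum.swap) (simp add: shift sum_distrib_right flip: sum_distrib_left)
qed

context cubic_prime
begin

lemma periodic_chi: "periodic p \<chi>"
  using chi_mod_cong by (simp add: periodic_def)

lemma p_pos: "p > 0" using p_ge by simp

lemma sum_chi: "(\<Sum>i\<in>{0..<int p}. \<chi> i) = 0"
proof -
  obtain g where g: "\<not> int p dvd g" "\<chi> g \<noteq> 1" using chi_nontrivial by blast
  have "\<chi> g * (\<Sum>i\<in>{0..<int p}. \<chi> i) = (\<Sum>i\<in>{0..<int p}. \<chi> i)"
    using sum_mult_periodic[OF prime_p g(1) periodic_chi] by (simp add: chi_mult sum_distrib_left)
  then have "(\<chi> g - 1) * (\<Sum>i\<in>{0..<int p}. \<chi> i) = 0" by (simp add: algebra_simps)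
  then show ?thesis using g by simp
qed

definition jacobi :: eisenstein where "jacobi = conv p \<chi> \<chi> 1"

lemma chi_square: "\<chi> n ^ 2 = eis_cnj (\<chi> n)"
  using cube_units_square chi_cases chi_0 by (cases "int p dvd n") auto

lemma chi_mult_cnj: "\<chi> n * eis_cnj (\<chi> n) = (if int p dvd n then 0 else 1)"
  using cube_units_mult_cnj chi_cases chi_0 by (cases "int p dvd n") auto

lemma conv_scale:
  assumes "\<not> int p dvd s" "\<And>a b. f (a * b) = f a * f b" "\<And>a b. g (a * b) = g a * g b"
    "periodic p f" "periodic p g"
  shows "conv p f g s = f s * g s * conv p f g 1"
proof -
  have per: "periodic p (\<lambda>i. f i * g (s - i))"
    using assms(4,5) unfolding periodic_def
    by (intro allI impI arg_cong2[where f = times]) (blast intro: cong_diff[OF cong_refl])+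
  have "conv p f g s = (\<Sum>i\<in>{0..<int p}. f (s * i) * g (s - s * i))"
    unfolding conv_def by (rule sum_mult_periodic[OF prime_p assms(1) per, symmetric])
  also have "\<dots> = (\<Sum>i\<in>{0..<int p}. f s * g s * (f i * g (1 - i)))"
  proof (rule sum.cong)
    fix i
    have "g (s - s * i) = g s * g (1 - i)" by (simp add: algebra_simps flip: assms(3))
    then show "f (s * i) * g (s - s * i) = f s * g s * (f i * g (1 - i))"
      by (simp add: assms(2))
  qed simp
  finally show ?thesis by (simp add: conv_def sum_distrib_left)
qed

lemma conv_chi_chi: "conv p \<chi> \<chi> s = jacobi * eis_cnj (\<chi> s)"
proof (cases "int p dvd s")
  case True
  have "\<chi> (s - i) = \<chi> i" for i
  proof -
    have "[s - i = - i] (mod int p)" using True by (simp add: cong_iff_dvd_diff)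
    then show ?thesis using chi_mod_cong chi_minus by metis
  qed
  then have "conv p \<chi> \<chi> s = (\<Sum>i\<in>{0..<int p}. \<chi> i ^ 2)"
    by (simp add: conv_def power2_eq_square)
  also have "\<dots> = 0" using sum_chi by (simp add: chi_square flip: eis_cnj_sum)
  finally show ?thesis using True by (simp add: chi_0)
next
  case False
  have "conv p \<chi> \<chi> s = \<chi> s * \<chi> s * jacobi"
    unfolding jacobi_def by (rule conv_scale[OF False]) (simp_all add: chi_mult periodic_chi)
  then show ?thesis using chi_square[of s] by (simp add: power2_eq_square mult.commute)
qed

definition chi_cnj :: "int \<Rightarrow> eisenstein" where "chi_cnj n = eis_cnj (\<chi> n)"

lemma chi_cnj_mult: "chi_cnj (a * b) = chi_cnj a * chi_cnj b"
  by (simp add: chi_cnj_def chi_mult eis_cnj_mult)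

definition ramanujan_sum :: "int \<Rightarrow> eisenstein" where
  "ramanujan_sum n = (if int p dvd n then of_nat p - 1 else - 1)"

lemma periodic_chi_cnj: "periodic p chi_cnj"
  using periodic_chi by (auto simp: periodic_def chi_cnj_def)

lemma conv_chi_cnj_chi_cnj: "conv p chi_cnj chi_cnj s = eis_cnj jacobi * \<chi> s"
proof -
  have "conv p chi_cnj chi_cnj s = eis_cnj (conv p \<chi> \<chi> s)"
    by (simp add: conv_def chi_cnj_def eis_cnj_sum eis_cnj_mult)
  then show ?thesis by (simp add: conv_chi_chi eis_cnj_mult)
qed

lemma sum_split_0:
  fixes f :: "int \<Rightarrow> eisenstein"
  assumes "\<And>i. \<not> int p dvd i \<Longrightarrow> f i = c"
  shows "(\<Sum>i\<in>{0..<int p}. f i) = f 0 + (of_nat p - 1) * c"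
proof -
  have e: "{0..<int p} = insert 0 {1..<int p}" using p_pos by auto
  have "(\<Sum>i\<in>{1..<int p}. f i) = (\<Sum>i\<in>{1..<int p}. c)"
    by (rule sum.cong[OF refl], rule assms) (auto dest: zdvd_imp_le)
  then show ?thesis using p_pos by (simp add: e of_nat_diff)
qed

lemma conv_chi_cnj_chi: "conv p chi_cnj \<chi> s = ramanujan_sum s"
proof -
  have v0: "conv p chi_cnj \<chi> s = of_nat p - 1" if "int p dvd s" for s
  proof -
    have "\<chi> (s - i) = \<chi> i" for i
    proof -
      have "[s - i = - i] (mod int p)" using that by (simp add: cong_iff_dvd_diff)
      then show ?thesis using chi_mod_cong chi_minus by metis
    qed
    then have "conv p chi_cnj \<chi> s = (\<Sum>i\<in>{0..<int p}. if int p dvd i then 0 else 1)"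
      by (simp add: conv_def chi_cnj_def mult.commute chi_mult_cnj)
    also have "\<dots> = of_nat p - 1" by (subst sum_split_0[of _ 1]) auto
    finally show ?thesis .
  qed
  define c where "c = conv p chi_cnj \<chi> 1"
  have v1: "conv p chi_cnj \<chi> s = c" if "\<not> int p dvd s" for s
  proof -
    have "conv p chi_cnj \<chi> s = chi_cnj s * \<chi> s * c"
      unfolding c_def
      by (rule conv_scale[OF that]) (simp_all add: chi_mult chi_cnj_mult periodic_chi periodic_chi_cnj)
    then show ?thesis using that chi_mult_cnj[of s] by (simp add: chi_cnj_def mult.commute)
  qed
  have "0 = (\<Sum>s\<in>{0..<int p}. conv p chi_cnj \<chi> s)"
    by (simp add: sum_conv[OF p_pos periodic_chi] sum_chi)
  also have "\<dots> = (of_nat p - 1) + (of_nat p - 1) * c"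
    by (subst sum_split_0[of _ c]) (auto simp: v0 v1)
  finally have "(of_nat p - 1) * (1 + c) = 0" by (simp only: distrib_left mult_1_right)
  moreover have "(of_nat p - 1 :: eisenstein) \<noteq> 0" using p_ge by (simp add: of_nat_eisenstein eis_simps)
  ultimately have "c = -1" by (simp add: add_eq_0_iff)
  then show ?thesis using v0 v1 by (simp add: ramanujan_sum_def)
qed

lemma conv_ramanujan_chi: "conv p ramanujan_sum \<chi> s = of_nat p * \<chi> s"
proof -
  have "conv p ramanujan_sum \<chi> s = (\<Sum>i\<in>{0..<int p}. (if int p dvd i then of_nat p * \<chi> (s - i) else 0) - \<chi> (s - i))"
    unfolding conv_def by (rule sum.cong) (auto simp: ramanujan_sum_def algebra_simps)
  also have "\<dots> = (\<Sum>i\<in>{0..<int p}. (if int p dvd i then of_nat p * \<chi> (s - i) else 0))"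
    by (simp add: sum_subtractf sum_diff_periodic[OF p_pos periodic_chi] sum_chi)
  also have "\<dots> = of_nat p * \<chi> s" by (subst sum_split_0[of _ 0]) auto
  finally show ?thesis .
qed

lemma power_sum:
  assumes "k < p - 1"
  shows "int p dvd (\<Sum>x\<in>{0..<int p}. x ^ k)"
proof (cases "k = 0")
  case False
  then obtain g where g: "\<not> int p dvd g" "\<not> [g ^ k = 1] (mod int p)"
    using nontrivial_exists[of k] assms by blast
  let ?S = "\<Sum>x\<in>{0..<int p}. x ^ k"
  have "periodic p (\<lambda>x. x ^ k mod int p)"
    using cong_pow by (auto simp: periodic_def cong_def)
  from sum_mult_periodic[OF prime_p g(1) this]
  have "(\<Sum>x\<in>{0..<int p}. (g * x) ^ k mod int p) mod int p = (\<Sum>x\<in>{0..<int p}. x ^ k mod int p) mod int p"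
    by simp
  then have "[g ^ k * ?S = ?S] (mod int p)"
    by (simp add: mod_sum_eq power_mult_distrib cong_def sum_distrib_left)
  then have "int p dvd (g ^ k - 1) * ?S" by (simp add: cong_iff_dvd_diff algebra_simps)
  then show ?thesis using g(2) prime_int_p prime_dvd_mult_iff unfolding cong_iff_dvd_diff by blast
qed simp

lemma poly_sum:
  fixes f :: "int poly"
  assumes "degree f < p - 1"
  shows "int p dvd (\<Sum>x\<in>{0..<int p}. poly f x)"
proof -
  have "(\<Sum>x\<in>{0..<int p}. poly f x) = (\<Sum>i\<le>degree f. coeff f i * (\<Sum>x\<in>{0..<int p}. x ^ i))"
    by (simp add: poly_altdef sum_distrib_left) (rule sum.swap)
  also have "int p dvd \<dots>"
    by (rule dvd_sum) (use assms power_sum in auto)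
  finally show ?thesis .
qed

lemma pi_dvd_jacobi: "\<pi> dvd jacobi"
proof -
  let ?f = "monom 1 m * [:1, -1:] ^ m :: int poly"
  have "\<pi> dvd (\<Sum>i\<in>{0..<int p}. of_int i ^ m * of_int (1 - i) ^ m) - jacobi"
    unfolding jacobi_def conv_def by (intro dvd_diff_sum dvd_diff_mult chi_cong)
  moreover have "\<pi> dvd (\<Sum>i\<in>{0..<int p}. of_int i ^ m * of_int (1 - i) ^ m)"
  proof -
    have "degree ?f \<le> degree (monom 1 m :: int poly) + degree ([:1, -1:] ^ m :: int poly)"
      by (rule degree_mult_le)
    also have "\<dots> \<le> m + 1 * m"
      by (intro add_mono degree_monom_le order_trans[OF degree_power_le]) simp
    also have "\<dots> < p - 1" using p_eq m_pos by linarith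
    finally have "int p dvd (\<Sum>x\<in>{0..<int p}. poly ?f x)" by (rule poly_sum)
    then have "\<pi> dvd of_int (\<Sum>x\<in>{0..<int p}. poly ?f x)" by (simp only: pi_dvd_int_iff)
    then show ?thesis by (simp add: poly_monom)
  qed
  ultimately show ?thesis by (metis dvd_diff_right_iff)
qed

end

section \<open>Gauss sums in the group ring of a cyclic group\<close>

definition cyc_ideal :: "nat \<Rightarrow> 'a::comm_ring_1 \<Rightarrow> 'a poly \<Rightarrow> bool" where
  "cyc_ideal p c f \<longleftrightarrow> (\<exists>u v. f = (monom 1 p - 1) * u + [:c:] * v)"

lemma cyc_ideal_0: "cyc_ideal p c 0"
  unfolding cyc_ideal_def by (intro exI[of _ 0]) simp

lemma cyc_ideal_add:
  assumes "cyc_ideal p c f" "cyc_ideal p c g"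
  shows "cyc_ideal p c (f + g)"
proof -
  obtain u v u' v' where *: "f = (monom 1 p - 1) * u + [:c:] * v" "g = (monom 1 p - 1) * u' + [:c:] * v'"
    using assms unfolding cyc_ideal_def by blast
  have "f + g = (monom 1 p - 1) * (u + u') + [:c:] * (v + v')" by (simp only: * distrib_left add_ac)
  then show ?thesis unfolding cyc_ideal_def by blast
qed

lemma cyc_ideal_mult:
  assumes "cyc_ideal p c f"
  shows "cyc_ideal p c (g * f)"
proof -
  obtain u v where *: "f = (monom 1 p - 1) * u + [:c:] * v"
    using assms unfolding cyc_ideal_def by blast
  have "g * f = (monom 1 p - 1) * (g * u) + [:c:] * (g * v)" by (simp only: * distrib_left mult_ac)
  then show ?thesis unfolding cyc_ideal_def by blast
qed

lemma cyc_ideal_dvd: "monom 1 p - 1 dvd f \<Longrightarrow> cyc_ideal p c f"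
  unfolding cyc_ideal_def by (metis add.right_neutral dvd_def mult_zero_right)

lemma cyc_ideal_const: "[:c:] dvd f \<Longrightarrow> cyc_ideal p c f"
  unfolding cyc_ideal_def by (metis add.left_neutral dvd_def mult_zero_right)

lemma cyc_ideal_0_imp: "cyc_ideal p 0 f \<Longrightarrow> cyc_ideal p c f"
  by (rule cyc_ideal_dvd) (auto simp: cyc_ideal_def)

text \<open>Summing the coefficients over a residue class modulo \<open>p\<close> annihilates the multiples
  of \<open>x\<^sup>p - 1\<close>, since the sum telescopes.\<close>

lemma cyc_ideal_coeff:
  assumes "cyc_ideal p c f" "p > 0" "\<And>i. i \<ge> p \<Longrightarrow> coeff f i = 0" "s < p"
  shows "c dvd coeff f s"
proof -
  obtain u v where f: "f = (monom 1 p - 1) * u + [:c:] * v"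
    using assms(1) unfolding cyc_ideal_def by blast
  define N where "N = degree u + 1"
  have tele: "(\<Sum>j\<le>n. coeff ((monom 1 p - 1) * u) (s + j * p)) = - coeff u (s + n * p)" for n
  proof (induction n)
    case 0
    then show ?case using assms(4) by (simp add: left_diff_distrib coeff_monom_mult)
  next
    case (Suc n)
    have "coeff ((monom 1 p - 1) * u) (s + Suc n * p) = coeff u (s + n * p) - coeff u (s + Suc n * p)"
      by (simp add: left_diff_distrib coeff_monom_mult)
    then show ?case using Suc by simp
  qed
  have "s + N * p > degree u"
  proof -
    have "N * p \<ge> N * 1" using assms(2) by (intro mult_le_mono) auto
    then show ?thesis by (simp add: N_def)
  qed
  then have "(\<Sum>j\<le>N. coeff ((monom 1 p - 1) * u) (s + j * p)) = 0"
    by (simp add: tele coeff_eq_0)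
  then have "(\<Sum>j\<le>N. coeff f (s + j * p)) = (\<Sum>j\<le>N. c * coeff v (s + j * p))"
    by (simp add: f sum.distrib)
  also have "\<dots> = c * (\<Sum>j\<le>N. coeff v (s + j * p))" by (simp add: sum_distrib_left)
  also have "(\<Sum>j\<le>N. coeff f (s + j * p)) = (\<Sum>j\<in>{0}. coeff f (s + j * p))"
    by (rule sum.mono_neutral_right) (auto intro!: assms(3) trans_le_add2)
  finally show ?thesis by simp
qed

definition cyc_cong :: "nat \<Rightarrow> 'a::comm_ring_1 \<Rightarrow> 'a poly \<Rightarrow> 'a poly \<Rightarrow> bool" where
  "cyc_cong p c f g \<longleftrightarrow> cyc_ideal p c (f - g)"

lemma cyc_cong_refl: "cyc_cong p c f f"
  by (simp add: cyc_cong_def cyc_ideal_0)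

lemma cyc_cong_sym: "cyc_cong p c f g \<Longrightarrow> cyc_cong p c g f"
  using cyc_ideal_mult[of p c "f - g" "-1"] by (simp add: cyc_cong_def)

lemma cyc_cong_trans [trans]: "cyc_cong p c f g \<Longrightarrow> cyc_cong p c g h \<Longrightarrow> cyc_cong p c f h"
  using cyc_ideal_add[of p c "f - g" "g - h"] by (simp add: cyc_cong_def)

lemma cyc_cong_mult:
  assumes "cyc_cong p c f g" "cyc_cong p c f' g'"
  shows "cyc_cong p c (f * f') (g * g')"
proof -
  have "f * f' - g * g' = f' * (f - g) + g * (f' - g')" by (simp add: algebra_simps)
  then show ?thesis using assms by (simp add: cyc_cong_def cyc_ideal_add cyc_ideal_mult)
qed

lemma cyc_cong_sum:
  assumes "\<And>i. i \<in> I \<Longrightarrow> cyc_cong p c (f i) (g i)"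
  shows "cyc_cong p c (sum f I) (sum g I)"
  using assms
proof (induction I rule: infinite_finite_induct)
  case (insert x F)
  have "sum f (insert x F) - sum g (insert x F) = (f x - g x) + (sum f F - sum g F)"
    using insert by simp
  moreover have "cyc_cong p c (f x) (g x)" "cyc_cong p c (sum f F) (sum g F)"
    using insert by simp_all
  ultimately show ?case unfolding cyc_cong_def by (simp only: cyc_ideal_add)
qed (simp_all add: cyc_cong_refl)

lemma cyc_cong_0_imp: "cyc_cong p 0 f g \<Longrightarrow> cyc_cong p c f g"
  by (simp add: cyc_cong_def cyc_ideal_0_imp)

lemma cyc_cong_monom:
  fixes a :: "'a::comm_ring_1"
  shows "cyc_cong p c (monom a n) (monom a (n mod p))"
proof -
  have *: "monom a (k + n) = monom 1 k * monom a n" for k n and a :: 'a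
    by (simp add: mult_monom)
  have "monom 1 p - 1 dvd (monom 1 p) ^ (n div p) - (1 :: 'a poly) ^ (n div p)"
    by (rule dvd_diff_power) simp
  then have "monom 1 p - 1 dvd monom 1 (p * (n div p)) - (1 :: 'a poly)"
    by (simp add: monom_power)
  then have "monom 1 p - 1 dvd (monom 1 (p * (n div p)) - 1) * monom a (n mod p)" by simp
  also have "\<dots> = monom a n - monom a (n mod p)"
    by (simp add: left_diff_distrib flip: *)
  finally show ?thesis by (simp add: cyc_cong_def cyc_ideal_dvd)
qed

text \<open>The element of the group ring of \<open>\<int>/p\<int>\<close> with coefficients \<open>f\<close>: a Gauss sum with
  an indeterminate in place of the \<open>p\<close>-th root of unity.\<close>

definition grp_elem :: "nat \<Rightarrow> (int \<Rightarrow> 'a) \<Rightarrow> 'a::comm_ring_1 poly" where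
  "grp_elem p f = (\<Sum>i\<in>{0..<int p}. monom (f i) (nat i))"

lemma coeff_grp_elem:
  "coeff (grp_elem p f) s = (if s < p then f (int s) else 0)"
proof -
  have "coeff (grp_elem p f) s = (\<Sum>i\<in>{0..<int p}. if i = int s then f i else 0)"
    unfolding grp_elem_def coeff_sum by (rule sum.cong) auto
  then show ?thesis by simp
qed

lemma grp_elem_const_mult: "grp_elem p (\<lambda>s. c * f s) = [:c:] * grp_elem p f"
  by (rule poly_eqI) (simp add: coeff_grp_elem)

lemma cyc_cong_grp_elemD:
  assumes "cyc_cong p c ([:a:] * grp_elem p f) ([:b:] * grp_elem p g)" "s < p"
  shows "c dvd a * f (int s) - b * g (int s)"
proof -
  have "c dvd coeff ([:a:] * grp_elem p f - [:b:] * grp_elem p g) s"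
    by (rule cyc_ideal_coeff[OF assms(1)[unfolded cyc_cong_def] _ _ assms(2)])
      (use assms(2) in \<open>auto simp: coeff_grp_elem\<close>)
  then show ?thesis using assms(2) by (simp add: coeff_grp_elem)
qed

lemma grp_elem_mult:
  assumes "p > 0" "periodic p g"
  shows "cyc_cong p c (grp_elem p f * grp_elem p g) (grp_elem p (conv p f g))"
proof -
  have "grp_elem p f * grp_elem p g
      = (\<Sum>i\<in>{0..<int p}. \<Sum>j\<in>{0..<int p}. monom (f i * g j) (nat (i + j)))"
    unfolding grp_elem_def sum_product by (intro sum.cong) (auto simp: mult_monom nat_add_distrib)
  also have "cyc_cong p c \<dots> (\<Sum>i\<in>{0..<int p}. \<Sum>j\<in>{0..<int p}. monom (f i * g j) (nat (i + j) mod p))"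
    by (intro cyc_cong_sum cyc_cong_monom)
  also have "(\<Sum>i\<in>{0..<int p}. \<Sum>j\<in>{0..<int p}. monom (f i * g j) (nat (i + j) mod p))
      = (\<Sum>i\<in>{0..<int p}. \<Sum>s\<in>{0..<int p}. monom (f i * g (s - i)) (nat s))"
  proof (rule sum.cong[OF refl])
    fix i assume i: "i \<in> {0..<int p}"
    have bij: "bij_betw (\<lambda>j. (i + j) mod int p) {0..<int p} {0..<int p}"
      by (rule bij_betw_byWitness[where f' = "\<lambda>s. (s - i) mod int p"])
        (use assms(1) in \<open>auto simp: mod_diff_left_eq mod_add_right_eq\<close>)
    have "(\<Sum>s\<in>{0..<int p}. monom (f i * g (s - i)) (nat s))
        = (\<Sum>j\<in>{0..<int p}. monom (f i * g ((i + j) mod int p - i)) (nat ((i + j) mod int p)))"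
      by (rule sum.reindex_bij_betw[OF bij, symmetric])
    also have "\<dots> = (\<Sum>j\<in>{0..<int p}. monom (f i * g j) (nat (i + j) mod p))"
    proof (rule sum.cong[OF refl])
      fix j assume j: "j \<in> {0..<int p}"
      have "g ((i + j) mod int p - i) = g j"
        by (rule periodicD[OF assms(2)]) (simp add: cong_def mod_diff_left_eq)
      moreover have "nat ((i + j) mod int p) = nat (i + j) mod p"
        using i j by (simp add: nat_mod_distrib)
      ultimately show "monom (f i * g ((i + j) mod int p - i)) (nat ((i + j) mod int p))
          = monom (f i * g j) (nat (i + j) mod p)" by simp
    qed
    finally show "(\<Sum>j\<in>{0..<int p}. monom (f i * g j) (nat (i + j) mod p))
        = (\<Sum>s\<in>{0..<int p}. monom (f i * g (s - i)) (nat s))" by simp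
  qed
  also have "\<dots> = grp_elem p (conv p f g)"
    unfolding grp_elem_def conv_def by (subst sum.swap) (simp add: monom_sum)
  finally show ?thesis .
qed

context cubic_prime
begin

abbreviation "gauss \<equiv> grp_elem p \<chi>"
abbreviation "gauss_cnj \<equiv> grp_elem p chi_cnj"

lemma gauss_square: "cyc_cong p 0 (gauss ^ 2) ([:jacobi:] * gauss_cnj)"
proof -
  have "conv p \<chi> \<chi> = (\<lambda>s. jacobi * chi_cnj s)" by (simp add: fun_eq_iff conv_chi_chi chi_cnj_def)
  then show ?thesis using grp_elem_mult[OF p_pos periodic_chi, of 0 \<chi>]
    by (simp only: power2_eq_square grp_elem_const_mult)
qed

lemma gauss_cnj_square: "cyc_cong p 0 (gauss_cnj ^ 2) ([:eis_cnj jacobi:] * gauss)"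
proof -
  have "conv p chi_cnj chi_cnj = (\<lambda>s. eis_cnj jacobi * \<chi> s)" by (simp add: fun_eq_iff conv_chi_cnj_chi_cnj)
  then show ?thesis using grp_elem_mult[OF p_pos periodic_chi_cnj, of 0 chi_cnj]
    by (simp only: power2_eq_square grp_elem_const_mult)
qed

lemma gauss_cube: "cyc_cong p 0 (gauss ^ 3) ([:jacobi:] * grp_elem p ramanujan_sum)"
proof -
  have "gauss ^ 3 = gauss ^ 2 * gauss" by (simp add: power3_eq_cube power2_eq_square)
  also have "cyc_cong p 0 \<dots> ([:jacobi:] * gauss_cnj * gauss)"
    by (intro cyc_cong_mult gauss_square cyc_cong_refl)
  also have "[:jacobi:] * gauss_cnj * gauss = [:jacobi:] * (gauss_cnj * gauss)" by (simp only: mult.assoc)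
  also have "cyc_cong p 0 \<dots> ([:jacobi:] * grp_elem p (conv p chi_cnj \<chi>))"
    by (intro cyc_cong_mult grp_elem_mult p_pos periodic_chi cyc_cong_refl)
  also have "conv p chi_cnj \<chi> = ramanujan_sum" by (simp add: fun_eq_iff conv_chi_cnj_chi)
  finally show ?thesis .
qed

lemma gauss_cube_mult: "cyc_cong p 0 (gauss ^ 3 * gauss) ([:jacobi * of_nat p:] * gauss)"
proof -
  have "cyc_cong p 0 (gauss ^ 3 * gauss) ([:jacobi:] * grp_elem p ramanujan_sum * gauss)"
    by (intro cyc_cong_mult gauss_cube cyc_cong_refl)
  also have "\<dots> = [:jacobi:] * (grp_elem p ramanujan_sum * gauss)" by (simp only: mult.assoc)
  also have "cyc_cong p 0 \<dots> ([:jacobi:] * grp_elem p (conv p ramanujan_sum \<chi>))"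
    by (intro cyc_cong_mult grp_elem_mult p_pos periodic_chi cyc_cong_refl)
  also have "conv p ramanujan_sum \<chi> = (\<lambda>s. of_nat p * \<chi> s)" by (simp add: fun_eq_iff conv_ramanujan_chi)
  also have "[:jacobi:] * grp_elem p (\<lambda>s. of_nat p * \<chi> s) = [:jacobi * of_nat p:] * gauss"
    by (rule poly_eqI) (simp add: coeff_grp_elem)
  finally show ?thesis .
qed

lemma gauss_power_1: "cyc_cong p 0 (gauss ^ (3 * k + 1)) ([:(jacobi * of_nat p) ^ k:] * gauss)"
proof (induction k)
  case 0
  show ?case by (simp add: cyc_cong_refl flip: one_pCons)
next
  case (Suc k)
  have "3 * Suc k + 1 = 3 * k + 1 + 3" by simp
  then have "gauss ^ (3 * Suc k + 1) = gauss ^ (3 * k + 1) * gauss ^ 3" by (simp only: power_add)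
  also have "cyc_cong p 0 \<dots> ([:(jacobi * of_nat p) ^ k:] * gauss * gauss ^ 3)"
    by (intro cyc_cong_mult Suc cyc_cong_refl)
  also have "\<dots> = [:(jacobi * of_nat p) ^ k:] * (gauss ^ 3 * gauss)" by (simp only: mult_ac)
  also have "cyc_cong p 0 \<dots> ([:(jacobi * of_nat p) ^ k:] * ([:jacobi * of_nat p:] * gauss))"
    by (intro cyc_cong_mult gauss_cube_mult cyc_cong_refl)
  also have "\<dots> = [:(jacobi * of_nat p) ^ Suc k:] * gauss"
    by (rule poly_eqI) simp
  finally show ?case .
qed

lemma gauss_power_2: "cyc_cong p 0 (gauss ^ (3 * k + 2)) ([:(jacobi * of_nat p) ^ k * jacobi:] * gauss_cnj)"
proof -
  have "gauss ^ (3 * k + 2) = gauss ^ (3 * k + 1) * gauss" by simp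
  also have "cyc_cong p 0 \<dots> ([:(jacobi * of_nat p) ^ k:] * gauss * gauss)"
    by (rule cyc_cong_mult[OF gauss_power_1 cyc_cong_refl])
  also have "[:(jacobi * of_nat p) ^ k:] * gauss * gauss = [:(jacobi * of_nat p) ^ k:] * gauss ^ 2"
    by (simp only: mult.assoc power2_eq_square)
  also have "cyc_cong p 0 \<dots> ([:(jacobi * of_nat p) ^ k:] * ([:jacobi:] * gauss_cnj))"
    by (intro cyc_cong_mult gauss_square cyc_cong_refl)
  also have "\<dots> = [:(jacobi * of_nat p) ^ k * jacobi:] * gauss_cnj"
    by (rule poly_eqI) simp
  finally show ?thesis .
qed

lemma gauss_frobenius:
  assumes "prime q" "q \<noteq> p"
  shows "cyc_cong p (of_nat q) (gauss ^ q) (grp_elem p (\<lambda>s. (\<chi> s * chi_cnj (int q)) ^ q))"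
proof -
  have q: "\<not> int p dvd int q" using assms prime_p by (auto dest: primes_dvd_imp_eq)
  have "cyc_cong p (of_nat q) (gauss ^ q) (\<Sum>i\<in>{0..<int p}. monom (\<chi> i) (nat i) ^ q)"
    unfolding cyc_cong_def
  proof (rule cyc_ideal_const)
    have "(of_nat q :: eisenstein poly) dvd gauss ^ q - (\<Sum>i\<in>{0..<int p}. monom (\<chi> i) (nat i) ^ q)"
      unfolding grp_elem_def by (rule frobenius_sum[OF assms(1)]) simp
    then show "[:of_nat q:] dvd gauss ^ q - (\<Sum>i\<in>{0..<int p}. monom (\<chi> i) (nat i) ^ q)"
      by (simp only: of_nat_poly)
  qed
  also have "(\<Sum>i\<in>{0..<int p}. monom (\<chi> i) (nat i) ^ q)
      = (\<Sum>i\<in>{0..<int p}. monom (\<chi> i ^ q) (nat i * q))"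
    by (simp add: monom_power)
  also have "cyc_cong p (of_nat q) \<dots> (\<Sum>i\<in>{0..<int p}. monom (\<chi> i ^ q) ((nat i * q) mod p))"
    by (intro cyc_cong_sum cyc_cong_monom)
  also have "\<dots> = (\<Sum>i\<in>{0..<int p}. monom ((\<chi> ((int q * i) mod int p) * chi_cnj (int q)) ^ q)
      (nat ((int q * i) mod int p)))"
  proof (rule sum.cong[OF refl])
    fix i assume i: "i \<in> {0..<int p}"
    have "\<chi> ((int q * i) mod int p) * chi_cnj (int q) = \<chi> i * (\<chi> (int q) * chi_cnj (int q))"
      by (simp add: periodic_mod[OF periodic_chi] chi_mult)
    then have "\<chi> ((int q * i) mod int p) * chi_cnj (int q) = \<chi> i"
      using q chi_mult_cnj[of "int q"] by (simp add: chi_cnj_def)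
    moreover have "nat ((int q * i) mod int p) = (nat i * q) mod p"
      using i by (simp add: nat_mod_distrib nat_mult_distrib mult.commute)
    ultimately show "monom (\<chi> i ^ q) ((nat i * q) mod p)
        = monom ((\<chi> ((int q * i) mod int p) * chi_cnj (int q)) ^ q) (nat ((int q * i) mod int p))"
      by simp
  qed
  also have "\<dots> = grp_elem p (\<lambda>s. (\<chi> s * chi_cnj (int q)) ^ q)"
    unfolding grp_elem_def by (rule sum.reindex_bij_betw[OF bij_betw_mult_mod[OF prime_p q]])
  finally show ?thesis .
qed

lemma jacobi_cong: "3 dvd jacobi + 1"
proof -
  have "p \<noteq> 3" using p_ge by simp
  then have "cyc_cong p (of_nat 3) (gauss ^ 3) (grp_elem p (\<lambda>s. (\<chi> s * chi_cnj (int 3)) ^ 3))"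
    by (intro gauss_frobenius) auto
  with gauss_cube[THEN cyc_cong_0_imp]
  have "cyc_cong p (of_nat 3) ([:jacobi:] * grp_elem p ramanujan_sum) (grp_elem p (\<lambda>s. (\<chi> s * chi_cnj (int 3)) ^ 3))"
    using cyc_cong_sym cyc_cong_trans by blast
  then have "cyc_cong p (of_nat 3) ([:jacobi:] * grp_elem p ramanujan_sum) ([:1:] * grp_elem p (\<lambda>s. (\<chi> s * chi_cnj (int 3)) ^ 3))"
    by simp
  from cyc_cong_grp_elemD[OF this, of 1]
  have "3 dvd jacobi * ramanujan_sum 1 - (\<chi> 1 * chi_cnj 3) ^ 3" using p_ge by simp
  moreover have "ramanujan_sum 1 = -1" using prime_p by (auto simp: ramanujan_sum_def prime_nat_iff)
  moreover have "chi_cnj 3 ^ 3 = 1"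
  proof -
    have "\<not> int p dvd 3" using p_ge by (auto dest: zdvd_imp_le)
    then show ?thesis using chi_cube[of 3] by (metis chi_cnj_def eis_cnj_1 eis_cnj_power)
  qed
  ultimately have "3 dvd - (jacobi + 1)" by (simp add: chi_1)
  then show ?thesis by (simp only: dvd_minus_iff)
qed

lemma norm_jacobi: "eis_norm jacobi = int p"
proof -
  have "cyc_cong p 0 (gauss ^ 3 * gauss) (([:jacobi:] * gauss_cnj) * ([:jacobi:] * gauss_cnj))"
    using cyc_cong_mult[OF gauss_square gauss_square] by (simp add: power2_eq_square power3_eq_cube mult_ac)
  also have "([:jacobi:] * gauss_cnj) * ([:jacobi:] * gauss_cnj) = [:jacobi ^ 2:] * gauss_cnj ^ 2"
    by (simp add: power2_eq_square mult_ac)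
  also have "cyc_cong p 0 \<dots> ([:jacobi ^ 2:] * ([:eis_cnj jacobi:] * gauss))"
    by (intro cyc_cong_mult gauss_cnj_square cyc_cong_refl)
  also have "[:jacobi ^ 2:] * ([:eis_cnj jacobi:] * gauss) = [:jacobi ^ 2 * eis_cnj jacobi:] * gauss"
    by (rule poly_eqI) simp
  finally have "cyc_cong p 0 ([:jacobi ^ 2 * eis_cnj jacobi:] * gauss) ([:jacobi * of_nat p:] * gauss)"
    using gauss_cube_mult cyc_cong_sym cyc_cong_trans by blast
  from cyc_cong_grp_elemD[OF this, of 1]
  have "jacobi ^ 2 * eis_cnj jacobi = jacobi * of_nat p" using p_ge by (simp add: chi_1)
  then have "jacobi * (jacobi * eis_cnj jacobi - of_nat p) = 0" by (simp add: power2_eq_square algebra_simps)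
  moreover have "jacobi \<noteq> 0"
  proof
    assume "jacobi = 0"
    then have "of_nat 3 dvd (1 :: eisenstein)" using jacobi_cong by simp
    then show False by (simp only: of_nat_dvd_eis_iff) (simp add: eis_simps)
  qed
  ultimately have "jacobi * eis_cnj jacobi = of_nat p" by simp
  then show ?thesis by (simp add: eis_norm_def of_nat_eisenstein)
qed

lemma jacobi_eq: "jacobi = \<pi> \<or> jacobi = - \<pi>"
proof -
  obtain a b where ab: "\<pi> = Eis a b" by (cases \<pi>)
  obtain u where u: "jacobi = \<pi> * u" using pi_dvd_jacobi by (rule dvdE)
  obtain x y where xy: "u = Eis x y" by (cases u)
  have b: "3 dvd b" using omega_3 ab by simp
  have a: "\<not> 3 dvd a"
  proof
    assume "3 dvd a"
    then have "3 dvd a ^ 2 - a * b + b ^ 2" by (simp add: power2_eq_square b)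
    then have "3 dvd int p" using norm_pi by (simp add: eis_norm_eq ab)
    then show False using p_mod_3 by presburger
  qed
  have "eis_norm u = 1" using norm_jacobi p_pos by (simp add: u eis_norm_mult norm_pi)
  then have n: "x ^ 2 - x * y + y ^ 2 = 1" by (simp add: eis_norm_eq xy)
  have "of_nat 3 dvd jacobi + 1" using jacobi_cong by simp
  then have "3 dvd coord_omega (jacobi + 1)" unfolding of_nat_dvd_eis_iff by simp
  moreover have "coord_omega (jacobi + 1) = a * y + b * x - b * y"
    by (subst u) (simp add: ab xy eis_simps)
  ultimately have "3 dvd a * y + b * x - b * y" by simp
  then have "3 dvd a * y" using b by (metis dvd_add_left_iff dvd_diff_left_iff dvd_mult2)
  then have "3 dvd y" using a by (simp add: prime_dvd_mult_iff)
  then obtain k where k: "y = 3 * k" by (rule dvdE)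
  have "(2 * x - y) ^ 2 + 27 * k ^ 2 = 4" using n by (simp add: k power2_eq_square algebra_simps)
  moreover have "k ^ 2 \<ge> 1" if "k \<noteq> 0" 
    using that zero_less_power2[of k] by linarith
  ultimately have "k = 0" using zero_le_power2[of "2 * x - y"] by linarith
  then have "x ^ 2 = 1" "y = 0" using n k by auto
  then have "u = 1 \<or> u = -1" by (auto simp: xy eis_simps power2_eq_1_iff)
  then show ?thesis using u by auto
qed

lemma pi_power_jacobi: "even k \<Longrightarrow> jacobi ^ k = \<pi> ^ k"
  using jacobi_eq by auto

end

section \<open>Cubic reciprocity\<close>

context cubic_prime
begin

lemma chi_powers:
  assumes "\<not> int p dvd n"
  shows "chi_cnj n ^ (3 * k + 1) = chi_cnj n" "chi_cnj n ^ (3 * k + 2) = \<chi> n"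
proof -
  have "chi_cnj n \<in> cube_units" unfolding chi_cnj_def using assms chi_cases cube_units_cnj by blast
  then have "chi_cnj n ^ 3 = 1" "chi_cnj n ^ 2 = \<chi> n"
    using cube_units_cube cube_units_square by (auto simp: chi_cnj_def)
  then show "chi_cnj n ^ (3 * k + 1) = chi_cnj n" "chi_cnj n ^ (3 * k + 2) = \<chi> n"
    by (simp_all only: power_add power_mult power_one mult_1 power_one_right)
qed

lemma not_dvd_other_prime: "prime q \<Longrightarrow> q \<noteq> p \<Longrightarrow> \<not> int p dvd int q"
  using prime_p by (auto dest: primes_dvd_imp_eq)

lemma reciprocity_1:
  assumes "prime q" "q \<noteq> p" "q = 3 * k + 1"
  shows "of_nat q dvd (\<pi> * of_nat p) ^ k - eis_cnj (\<chi> (int q))"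
proof -
  have "cyc_cong p (of_nat q) ([:(jacobi * of_nat p) ^ k:] * gauss) (grp_elem p (\<lambda>s. (\<chi> s * chi_cnj (int q)) ^ q))"
    using gauss_frobenius[OF assms(1,2)] cyc_cong_0_imp[OF gauss_power_1[of k]]
    unfolding assms(3)[symmetric] by (meson cyc_cong_sym cyc_cong_trans)
  then have "cyc_cong p (of_nat q) ([:(jacobi * of_nat p) ^ k:] * gauss)
      ([:1:] * grp_elem p (\<lambda>s. (\<chi> s * chi_cnj (int q)) ^ q))"
    by simp
  from cyc_cong_grp_elemD[OF this, of 1]
  have "of_nat q dvd (jacobi * of_nat p) ^ k - chi_cnj (int q) ^ q"
    using p_ge by (simp add: chi_1)
  moreover have "chi_cnj (int q) ^ q = eis_cnj (\<chi> (int q))"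
    using chi_powers(1)[OF not_dvd_other_prime[OF assms(1,2)], of k]
    unfolding assms(3)[symmetric] by (simp only: chi_cnj_def)
  moreover have "even k"
    using assms(1) prime_odd_nat[of q] assms(3) by (cases "q = 2") (auto, presburger+)
  ultimately show ?thesis using pi_power_jacobi by (simp add: power_mult_distrib)
qed

lemma reciprocity_2:
  assumes "prime q" "q \<noteq> p" "q \<noteq> 2" "q = 3 * k + 2"
  shows "of_nat q dvd (\<pi> * of_nat p) ^ k * \<pi> - \<chi> (int q)"
proof -
  have "cyc_cong p (of_nat q) ([:(jacobi * of_nat p) ^ k * jacobi:] * gauss_cnj) (grp_elem p (\<lambda>s. (\<chi> s * chi_cnj (int q)) ^ q))"
    using gauss_frobenius[OF assms(1,2)] cyc_cong_0_imp[OF gauss_power_2[of k]]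
    unfolding assms(4)[symmetric] by (meson cyc_cong_sym cyc_cong_trans)
  then have "cyc_cong p (of_nat q) ([:(jacobi * of_nat p) ^ k * jacobi:] * gauss_cnj)
      ([:1:] * grp_elem p (\<lambda>s. (\<chi> s * chi_cnj (int q)) ^ q))"
    by simp
  from cyc_cong_grp_elemD[OF this, of 1]
  have "of_nat q dvd (jacobi * of_nat p) ^ k * jacobi - chi_cnj (int q) ^ q"
    using p_ge by (simp add: chi_1 chi_cnj_def)
  moreover have "chi_cnj (int q) ^ q = \<chi> (int q)"
    using chi_powers(2)[OF not_dvd_other_prime[OF assms(1,2)], of k]
    unfolding assms(4)[symmetric] .
  moreover have "(jacobi * of_nat p) ^ k * jacobi = (\<pi> * of_nat p) ^ k * \<pi>"
  proof -
    have "odd q" using assms(1,3) prime_odd_nat[of q] prime_gt_1_nat[of q] by fastforce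
    then have "even (Suc k)" using assms(4) by presburger
    then have "jacobi ^ Suc k = \<pi> ^ Suc k" by (rule pi_power_jacobi)
    then show ?thesis by (simp add: power_mult_distrib mult_ac)
  qed
  ultimately show ?thesis by simp
qed

end

section \<open>Cubes among the slopes modulo a rational prime\<close>

locale rational_modulus =
  fixes q m :: nat
  assumes prime_q: "prime q" and q_ge: "q \<ge> 5" and q_cases: "q = 3 * m + 1 \<or> q + 1 = 3 * m"
begin

lemma prime_int_q: "prime (int q)" using prime_q by simp

lemma m_bounds: "0 < m" "m < q" using q_cases q_ge by auto

lemma q_dvd_small: "int q dvd n \<Longrightarrow> \<bar>n\<bar> < 5 \<Longrightarrow> n = 0"
  using q_ge by (metis dvd_imp_le_int of_nat_le_iff of_nat_numeral order_less_le_trans abs_of_nat linorder_not_less)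

lemma q_dvd_mult_iff: "int q dvd a * b \<longleftrightarrow> int q dvd a \<or> int q dvd b"
  using prime_int_q by (rule prime_dvd_mult_iff)

lemma q_dvd_power: "int q dvd a ^ n \<Longrightarrow> int q dvd a"
  using prime_int_q by (rule prime_dvd_power)

lemma cancel_int:
  assumes "of_nat q dvd of_int n * w" "\<not> int q dvd n"
  shows "of_nat q dvd (w :: eisenstein)"
proof -
  have "coord_one (of_int n * w) = n * coord_one w" "coord_omega (of_int n * w) = n * coord_omega w"
    by (simp_all add: eis_simps)
  then show ?thesis using assms by (simp add: of_nat_dvd_eis_iff q_dvd_mult_iff)
qed

lemma cancel_power:
  assumes "\<not> int q dvd eis_norm z"
  shows "of_nat q dvd z ^ n * w \<longleftrightarrow> of_nat q dvd w"
proof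
  assume "of_nat q dvd z ^ n * w"
  then have "of_nat q dvd eis_cnj z ^ n * (z ^ n * w)" by (rule dvd_mult)
  also have "eis_cnj z ^ n * (z ^ n * w) = (z * eis_cnj z) ^ n * w"
    by (simp only: power_mult_distrib mult_ac)
  also have "\<dots> = of_int (eis_norm z ^ n) * w" by (simp only: mult_eis_cnj of_int_power)
  finally show "of_nat q dvd w" using assms q_dvd_power by (blast intro: cancel_int)
qed simp

lemma real_iff: "of_nat q dvd w - eis_cnj w \<longleftrightarrow> int q dvd coord_omega w"
  by (auto simp: of_nat_dvd_eis_iff eis_simps)

lemma power_q: 
  shows "q = 3 * m + 1 \<Longrightarrow> of_nat q dvd z ^ q - (z :: eisenstein)"
    and "q + 1 = 3 * m \<Longrightarrow> of_nat q dvd z ^ q - eis_cnj z"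
proof -
  assume "q = 3 * m + 1"
  then have "q mod 3 = 1" by presburger
  then show "of_nat q dvd z ^ q - z" by (rule frobenius_eis_1[OF prime_q])
next
  assume "q + 1 = 3 * m"
  then have "q mod 3 = 2" by presburger
  then show "of_nat q dvd z ^ q - eis_cnj z" by (rule frobenius_eis_2[OF prime_q])
qed

lemma power_3m_1:
  assumes "\<not> int q dvd eis_norm z" "q = 3 * m + 1"
  shows "of_nat q dvd z ^ (3 * m) - 1"
proof -
  have "z ^ q - z = z ^ 1 * (z ^ (3 * m) - 1)"
    by (simp add: algebra_simps) (simp only: assms(2) power_add power_one_right mult.commute)
  then show ?thesis using power_q(1)[OF assms(2), of z] cancel_power[OF assms(1)] by metis
qed

lemma power_3m_real:
  assumes "\<not> int q dvd eis_norm z"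
  shows "int q dvd coord_omega (z ^ (3 * m))"
  using q_cases
proof
  assume "q = 3 * m + 1"
  then have "int q dvd coord_omega (z ^ (3 * m) - 1)"
    using power_3m_1[OF assms] unfolding of_nat_dvd_eis_iff by blast
  then show ?thesis by (simp add: eis_simps)
next
  assume q: "q + 1 = 3 * m"
  have "of_nat q dvd z ^ q * z - eis_cnj z * z"
    by (intro dvd_diff_mult power_q(2)[OF q]) simp
  moreover have "z ^ q * z = z ^ (3 * m)" unfolding q[symmetric] by simp
  moreover have "eis_cnj z * z = of_int (eis_norm z)" by (simp add: mult_eis_cnj mult.commute)
  ultimately have "int q dvd coord_omega (z ^ (3 * m) - of_int (eis_norm z))"
    by (simp add: of_nat_dvd_eis_iff)
  then show ?thesis by (simp add: eis_simps)
qed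

lemma norm_cong: "of_nat q dvd x - y \<Longrightarrow> int q dvd eis_norm x - eis_norm y"
proof -
  assume "of_nat q dvd x - y"
  moreover from this have "of_nat q dvd eis_cnj x - eis_cnj y"
    using eis_cnj_dvd[of "of_nat q" "x - y"] by (simp add: eis_cnj_diff)
  ultimately have "of_nat q dvd x * eis_cnj x - y * eis_cnj y" by (rule dvd_diff_mult)
  then have "of_nat q dvd (of_int (eis_norm x - eis_norm y) :: eisenstein)"
    by (simp add: mult_eis_cnj)
  then show ?thesis by (simp only: of_nat_dvd_eis_iff of_int_eisenstein) simp
qed

lemma proportional:
  assumes "of_nat q dvd of_int c * z - of_int d * w" "\<not> int q dvd c"
  shows "int q dvd coord_omega (w ^ n) \<Longrightarrow> int q dvd coord_omega (z ^ n)"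
    and "int q dvd eis_norm w \<Longrightarrow> int q dvd eis_norm z"
proof -
  have "of_nat q dvd (of_int c * z) ^ n - (of_int d * w) ^ n" by (rule dvd_diff_power[OF assms(1)])
  moreover have "coord_omega ((of_int c * z) ^ n) = c ^ n * coord_omega (z ^ n)" for c z
    unfolding power_mult_distrib of_int_power[symmetric] by (simp add: eis_simps)
  ultimately have *: "int q dvd c ^ n * coord_omega (z ^ n) - d ^ n * coord_omega (w ^ n)"
    by (simp add: of_nat_dvd_eis_iff minus_eisenstein_def)
  show "int q dvd coord_omega (z ^ n)" if "int q dvd coord_omega (w ^ n)"
  proof -
    have "int q dvd c ^ n * coord_omega (z ^ n)" using * that by (metis dvd_diff_left_iff dvd_mult)
    then show ?thesis using assms(2) q_dvd_mult_iff q_dvd_power by blast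
  qed
  show "int q dvd eis_norm z" if "int q dvd eis_norm w"
  proof -
    have "int q dvd c ^ 2 * eis_norm z - d ^ 2 * eis_norm w"
      using norm_cong[OF assms(1)] by (simp add: eis_norm_mult eis_norm_of_int)
    then have "int q dvd c ^ 2 * eis_norm z" using that by (metis dvd_diff_left_iff dvd_mult)
    then show ?thesis using assms(2) q_dvd_mult_iff q_dvd_power by blast
  qed
qed

text \<open>\<open>line t\<close> is \<open>t + \<surd>-3\<close>. An element that is not congruent to an integer modulo \<open>q\<close>
  is congruent to an integer multiple of some \<open>line t\<close>.\<close>

definition line :: "int \<Rightarrow> eisenstein" where "line t = Eis (t + 1) 2"

lemma norm_line: "eis_norm (line t) = t ^ 2 + 3"
  by (simp add: line_def eis_norm_eq power2_eq_square algebra_simps)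

lemma line_cube: "line t ^ 3 = Eis (t ^ 3 - 9 * t + 3 * (t ^ 2 - 1)) (6 * (t ^ 2 - 1))"
  by (simp add: line_def eval_nat_numeral eis_simps algebra_simps)

lemma line_power_poly:
  "\<exists>U V :: int poly. (\<forall>t. line t ^ n = Eis (poly U t + poly V t) (2 * poly V t)) \<and>
     (\<forall>i>n. coeff U i = 0) \<and> coeff U n = 1 \<and>
     (\<forall>i\<ge>n. coeff V i = 0) \<and> (n > 0 \<longrightarrow> coeff V (n - 1) = int n)"
proof (induction n)
  case 0
  show ?case by (intro exI[of _ 1] exI[of _ 0]) (simp add: one_eisenstein_def)
next
  case (Suc n)
  then obtain U V where
    *: "\<And>t. line t ^ n = Eis (poly U t + poly V t) (2 * poly V t)"
    "\<And>i. i > n \<Longrightarrow> coeff U i = 0" "coeff U n = 1"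
    "\<And>i. i \<ge> n \<Longrightarrow> coeff V i = 0" "n > 0 \<Longrightarrow> coeff V (n - 1) = int n" by blast
  show ?case
  proof (rule exI[of _ "pCons 0 U - smult 3 V"], rule exI[of _ "U + pCons 0 V"], intro conjI allI impI)
    fix t
    show "line t ^ Suc n = Eis (poly (pCons 0 U - smult 3 V) t + poly (U + pCons 0 V) t)
        (2 * poly (U + pCons 0 V) t)"
      by (simp add: *(1)) (simp add: line_def times_eisenstein_def algebra_simps)
  qed (use *(2-5) in \<open>auto simp: coeff_pCons split: nat.split\<close>)
qed

definition real_slopes :: "int set" where
  "real_slopes = {u \<in> {0..<int q}. int q dvd coord_omega (line u ^ m)}"

lemma card_real_slopes: "card real_slopes \<le> m - 1"
proof -
  obtain U V :: "int poly" where
    *: "\<And>t. line t ^ m = Eis (poly U t + poly V t) (2 * poly V t)"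
    "\<And>i. i \<ge> m \<Longrightarrow> coeff V i = 0" "coeff V (m - 1) = int m"
    using line_power_poly[of m] m_bounds(1) by blast
  have two: "\<not> int q dvd 2" using q_dvd_small[of 2] by auto
  have "real_slopes = {u \<in> {0..<int q}. int q dvd poly V u}"
    unfolding real_slopes_def * by (simp add: q_dvd_mult_iff two)
  also have "card \<dots> \<le> m - 1"
  proof (rule card_roots_mod_prime_le[OF prime_q])
    show "\<not> int q dvd coeff V (m - 1)" using m_bounds *(3) by (auto dest: zdvd_imp_le)
    show "degree V \<le> m - 1" using *(2) m_bounds(1) by (intro degree_le) auto
  qed
  finally show ?thesis .
qed

lemma no_root_case_2:
  assumes "q + 1 = 3 * m"
  shows "\<not> int q dvd t ^ 2 + 3"
proof
  assume t: "int q dvd t ^ 2 + 3"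
  have sq: "of_nat q dvd line t ^ 2 - of_int (2 * t) * line t"
  proof -
    have "line t ^ 2 - of_int (2 * t) * line t = of_int (- (t ^ 2 + 3))"
      by (simp only: power2_eq_square line_def) (simp add: eis_simps algebra_simps)
    then show ?thesis using t by (simp only: of_nat_dvd_eis_iff of_int_eisenstein) (simp only: eisenstein.sel dvd_minus_iff dvd_0_right)
  qed
  have pow: "of_nat q dvd line t ^ Suc n - of_int ((2 * t) ^ n) * line t" for n
  proof (induction n)
    case (Suc n)
    have "of_nat q dvd line t * line t ^ Suc n - line t * (of_int ((2 * t) ^ n) * line t)"
      by (rule dvd_diff_mult) (use Suc in simp_all)
    moreover have "of_nat q dvd of_int ((2 * t) ^ n) * line t ^ 2 - of_int ((2 * t) ^ n) * (of_int (2 * t) * line t)"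
      by (rule dvd_diff_mult) (use sq in simp_all)
    moreover have "line t * (of_int ((2 * t) ^ n) * line t) = of_int ((2 * t) ^ n) * line t ^ 2"
      by (simp only: power2_eq_square mult_ac)
    ultimately show ?case by (metis (no_types, lifting) dvd_diff_trans mult.assoc mult.commute of_int_mult power_Suc)
  qed simp
  obtain n where n: "q = Suc n" using q_ge by (cases q) auto
  define c where "c = (2 * t) ^ n"
  have "of_nat q dvd line t ^ q - of_int c * line t" using pow[of n] by (simp only: c_def n[symmetric])
  then have "of_nat q dvd of_int c * line t - eis_cnj (line t)"
    using power_q(2)[OF assms, of "line t"] dvd_diff_sym dvd_diff_trans by blast
  then have "int q dvd c * (t + 1) - (t - 1)" "int q dvd c * 2 + 2"
    by (simp_all add: of_nat_dvd_eis_iff line_def eis_simps)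
  then have "int q dvd 2 * (c * (t + 1) - (t - 1)) - (t + 1) * (c * 2 + 2)" by (metis dvd_diff dvd_mult)
  then have "int q dvd (-4) * t" by (simp add: algebra_simps)
  then have "int q dvd t" using q_dvd_small[of "-4"] q_dvd_mult_iff by auto
  then have "int q dvd t ^ 2" by (simp add: power2_eq_square)
  then have "int q dvd 3" using t by (metis dvd_add_right_iff)
  then show False using q_dvd_small[of 3] by simp
qed

definition generic_slopes :: "int set" where
  "generic_slopes = {t \<in> {0..<int q}. \<not> int q dvd t ^ 2 + 3 \<and> \<not> int q dvd t ^ 2 - 1}"

lemma card_generic_slopes: "3 * (m - 1) \<le> card generic_slopes"
proof -
  define A where "A c = {t \<in> {0..<int q}. int q dvd poly [:c, 0, 1:] t}" for c
  have A: "card (A c) \<le> 2" for c unfolding A_def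
  proof (rule card_roots_mod_prime_le[OF prime_q, of _ 2])
    show "\<not> int q dvd coeff [:c, 0, 1:] 2" using q_dvd_small[of 1] by (auto simp: numeral_2_eq_2)
  qed simp
  have fin: "finite (A c)" for c unfolding A_def by (rule finite_subset[of _ "{0..<int q}"]) auto
  have generic_slopes: "generic_slopes = {0..<int q} - (A 3 \<union> A (-1))"
    unfolding generic_slopes_def A_def by (auto simp: power2_eq_square algebra_simps)
  have "card {0..<int q} - card (A 3 \<union> A (-1)) \<le> card generic_slopes"
    unfolding generic_slopes by (rule diff_card_le_card_Diff) (simp add: fin)
  moreover have "card (A 3 \<union> A (-1)) \<le> card (A 3) + card (A (-1))" by (rule card_Un_le)
  ultimately have *: "q \<le> card generic_slopes + (card (A 3) + card (A (-1)))" by simp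
  show ?thesis using q_cases
  proof
    assume "q = 3 * m + 1"
    then show ?thesis using * A[of 3] A[of "-1"] by linarith
  next
    assume q: "q + 1 = 3 * m"
    have "int q dvd poly [:3, 0, 1:] t \<longleftrightarrow> int q dvd t ^ 2 + 3" for t
      by (simp add: power2_eq_square add.commute)
    then have "A 3 = {}" unfolding A_def using no_root_case_2[OF q] by simp
    then show ?thesis using * A[of "-1"] q by simp
  qed
qed

lemma solve_linear:
  assumes "\<not> int q dvd a"
  shows "\<exists>u\<in>{0..<int q}. int q dvd a * u - b"
proof -
  have "coprime a (int q)" using assms prime_int_q by (metis coprime_commute prime_imp_coprime)
  then obtain x where x: "[a * x = 1] (mod int q)" using cong_solve_coprime_int by blast
  have "[a * ((x * b) mod int q) = a * (x * b)] (mod int q)"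
    by (intro cong_scalar_left) (simp add: cong_def)
  also have "[a * (x * b) = b] (mod int q)"
    using cong_scalar_right[OF x, of b] by (simp add: mult.assoc)
  finally have "int q dvd a * ((x * b) mod int q) - b" by (simp add: cong_iff_dvd_diff)
  moreover have "(x * b) mod int q \<in> {0..<int q}" using q_ge by simp
  ultimately show ?thesis by blast
qed

text \<open>Cubing slopes is at most three-to-one and maps \<open>generic_slopes\<close> into \<open>real_slopes\<close>; by
  the two cardinality bounds it is onto.\<close>

lemma real_slopes_cubes:
  assumes "u \<in> real_slopes"
  shows "\<exists>t. int q dvd 3 * (t ^ 2 - 1) * u - (t ^ 3 - 9 * t)"
proof -
  have "\<forall>t\<in>generic_slopes. \<exists>u. u \<in> {0..<int q} \<and> int q dvd 3 * (t ^ 2 - 1) * u - (t ^ 3 - 9 * t)"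
  proof
    fix t assume "t \<in> generic_slopes"
    then have "\<not> int q dvd 3 * (t ^ 2 - 1)"
      using q_dvd_small[of 3] unfolding generic_slopes_def q_dvd_mult_iff by auto
    then show "\<exists>u. u \<in> {0..<int q} \<and> int q dvd 3 * (t ^ 2 - 1) * u - (t ^ 3 - 9 * t)"
      using solve_linear by blast
  qed
  then obtain h where h: "\<And>t. t \<in> generic_slopes \<Longrightarrow> h t \<in> {0..<int q}"
    "\<And>t. t \<in> generic_slopes \<Longrightarrow> int q dvd 3 * (t ^ 2 - 1) * h t - (t ^ 3 - 9 * t)" by metis
  have fin: "finite generic_slopes" "finite real_slopes"
    unfolding generic_slopes_def real_slopes_def by (rule finite_subset[of _ "{0..<int q}"]; auto)+
  have sub: "h ` generic_slopes \<subseteq> real_slopes"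
  proof
    fix v assume "v \<in> h ` generic_slopes"
    then obtain t where t: "t \<in> generic_slopes" "v = h t" by blast
    have "of_int (3 * (t ^ 2 - 1)) * line (h t) - of_int 1 * line t ^ 3
        = of_int (3 * (t ^ 2 - 1) * h t - (t ^ 3 - 9 * t))"
      unfolding line_cube by (simp add: line_def eis_simps algebra_simps)
    then have "of_nat q dvd of_int (3 * (t ^ 2 - 1)) * line (h t) - of_int 1 * line t ^ 3"
      using h(2)[OF t(1)] by (simp only: of_nat_dvd_eis_iff of_int_eisenstein eisenstein.sel dvd_0_right)
    moreover have "\<not> int q dvd 3 * (t ^ 2 - 1)"
      using t q_dvd_small[of 3] unfolding generic_slopes_def q_dvd_mult_iff by auto
    moreover have "int q dvd coord_omega ((line t ^ 3) ^ m)"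
      unfolding power_mult[symmetric] using t by (intro power_3m_real) (simp add: norm_line generic_slopes_def)
    ultimately have "int q dvd coord_omega (line (h t) ^ m)" by (rule proportional(1))
    then show "v \<in> real_slopes" using h(1) t by (simp add: real_slopes_def)
  qed
  have "card generic_slopes \<le> (\<Sum>v\<in>h ` generic_slopes. card {t \<in> {0..<int q}. int q dvd poly [:- 3 * v, 9, 3 * v, - 1:] t})"
  proof -
    have "generic_slopes \<subseteq> (\<Union>v\<in>h ` generic_slopes. {t \<in> {0..<int q}. int q dvd poly [:- 3 * v, 9, 3 * v, - 1:] t})"
    proof
      fix t assume t: "t \<in> generic_slopes"
      have "poly [:- 3 * h t, 9, 3 * h t, - 1:] t = 3 * (t ^ 2 - 1) * h t - (t ^ 3 - 9 * t)"
        by (simp add: power2_eq_square power3_eq_cube algebra_simps)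
      then show "t \<in> (\<Union>v\<in>h ` generic_slopes. {t \<in> {0..<int q}. int q dvd poly [:- 3 * v, 9, 3 * v, - 1:] t})"
        using h(2)[OF t] t unfolding generic_slopes_def by force
    qed
    then have "card generic_slopes \<le> card (\<Union>v\<in>h ` generic_slopes. {t \<in> {0..<int q}. int q dvd poly [:- 3 * v, 9, 3 * v, - 1:] t})"
      by (rule card_mono[rotated]) (auto intro: fin finite_subset[of _ "{0..<int q}"])
    also have "\<dots> \<le> (\<Sum>v\<in>h ` generic_slopes. card {t \<in> {0..<int q}. int q dvd poly [:- 3 * v, 9, 3 * v, - 1:] t})"
      by (rule card_UN_le) (use fin in simp)
    finally show ?thesis .
  qed
  also have "\<dots> \<le> (\<Sum>v\<in>h ` generic_slopes. 3)"
  proof (rule sum_mono)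
    fix v
    show "card {t \<in> {0..<int q}. int q dvd poly [:- 3 * v, 9, 3 * v, - 1:] t} \<le> 3"
    proof (rule card_roots_mod_prime_le[OF prime_q, of _ 3])
      show "\<not> int q dvd coeff [:- 3 * v, 9, 3 * v, - 1:] 3"
        using q_dvd_small[of "-1"] by (auto simp: numeral_3_eq_3)
    qed simp
  qed
  also have "\<dots> = 3 * card (h ` generic_slopes)" by simp
  finally have "m - 1 \<le> card (h ` generic_slopes)" using card_generic_slopes by linarith
  then have "h ` generic_slopes = real_slopes" using card_real_slopes by (intro card_seteq[OF fin(2) sub]) linarith
  then obtain t where "t \<in> generic_slopes" "u = h t" using assms by blast
  then show ?thesis using h(2) by blast
qed

lemma cube_criterion:
  assumes "\<not> int q dvd eis_norm (Eis e f)"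
  shows "int q dvd coord_omega (Eis e f ^ m) \<longleftrightarrow>
    (\<exists>t. [f * (t ^ 3 - 9 * t) = 3 * (2 * e - f) * (t ^ 2 - 1)] (mod int q))"
proof
  assume re: "int q dvd coord_omega (Eis e f ^ m)"
  show "\<exists>t. [f * (t ^ 3 - 9 * t) = 3 * (2 * e - f) * (t ^ 2 - 1)] (mod int q)"
  proof (cases "int q dvd f")
    case True
    then show ?thesis by (intro exI[of _ 1]) (simp add: cong_iff_dvd_diff)
  next
    case False
    then obtain u where u: "u \<in> {0..<int q}" "int q dvd f * u - (2 * e - f)"
      using solve_linear by blast
    have "of_int f * line u - of_int 2 * Eis e f = of_int (f * u - (2 * e - f))"
      by (simp only: line_def) (simp add: eis_simps algebra_simps)
    then have "of_nat q dvd of_int f * line u - of_int 2 * Eis e f"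
      using u(2) by (simp only: of_nat_dvd_eis_iff of_int_eisenstein eisenstein.sel dvd_0_right)
    then have "int q dvd coord_omega (line u ^ m)" by (rule proportional(1)[OF _ False re])
    then have "u \<in> real_slopes" using u by (simp add: real_slopes_def)
    then obtain t where t: "int q dvd 3 * (t ^ 2 - 1) * u - (t ^ 3 - 9 * t)"
      using real_slopes_cubes by blast
    have "f * (t ^ 3 - 9 * t) - 3 * (2 * e - f) * (t ^ 2 - 1)
        = 3 * (t ^ 2 - 1) * (f * u - (2 * e - f)) - f * (3 * (t ^ 2 - 1) * u - (t ^ 3 - 9 * t))"
      by (simp add: algebra_simps)
    also have "int q dvd \<dots>" by (rule dvd_diff[OF dvd_mult[OF u(2)] dvd_mult[OF t]])
    finally show ?thesis by (auto simp: cong_iff_dvd_diff)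
  qed
next
  assume "\<exists>t. [f * (t ^ 3 - 9 * t) = 3 * (2 * e - f) * (t ^ 2 - 1)] (mod int q)"
  then obtain t where t: "int q dvd f * (t ^ 3 - 9 * t) - 3 * (2 * e - f) * (t ^ 2 - 1)"
    by (auto simp: cong_iff_dvd_diff)
  have two: "\<not> int q dvd 2" using q_dvd_small[of 2] by auto
  have main: "int q dvd coord_omega (Eis e f ^ m)" if c: "\<not> int q dvd c" "of_nat q dvd of_int c * Eis e f - of_int d * line t ^ 3"
    for c d
  proof -
    have "\<not> int q dvd eis_norm (line t)"
    proof
      assume "int q dvd eis_norm (line t)"
      then have "int q dvd eis_norm (line t ^ 3)" by (simp add: eis_norm_mult power3_eq_cube)
      then show False using proportional(2)[OF c(2,1)] assms by blast
    qed
    then have "int q dvd coord_omega ((line t ^ 3) ^ m)"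
      unfolding power_mult[symmetric] by (rule power_3m_real)
    then show ?thesis using proportional(1)[OF c(2,1)] by blast
  qed
  show "int q dvd coord_omega (Eis e f ^ m)"
  proof (cases "int q dvd t ^ 2 - 1")
    case False
    have "of_int (6 * (t ^ 2 - 1)) * Eis e f - of_int f * line t ^ 3
        = of_int (3 * (2 * e - f) * (t ^ 2 - 1) - f * (t ^ 3 - 9 * t))"
      by (simp only: line_cube) (simp add: eis_simps algebra_simps)
    then have "of_nat q dvd of_int (6 * (t ^ 2 - 1)) * Eis e f - of_int f * line t ^ 3"
      using t by (simp only: of_nat_dvd_eis_iff of_int_eisenstein eisenstein.sel dvd_0_right dvd_diff_commute)
    moreover have "\<not> int q dvd 6 * (t ^ 2 - 1)"
    proof -
      have "\<not> int q dvd 2 * (3 * (t ^ 2 - 1))"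
        using False two q_dvd_small[of 3] unfolding q_dvd_mult_iff by auto
      moreover have "6 * (t ^ 2 - 1) = 2 * (3 * (t ^ 2 - 1))" by simp
      ultimately show ?thesis by metis
    qed
    ultimately show ?thesis using main by blast
  next
    case True
    have "of_int (2 * (t ^ 3 - 9 * t)) * Eis e f - of_int (2 * e - f) * line t ^ 3
        = of_int (f * (t ^ 3 - 9 * t) - 3 * (2 * e - f) * (t ^ 2 - 1)) * Eis 1 2"
      by (simp only: line_cube) (simp add: eis_simps algebra_simps)
    moreover have "of_nat q dvd of_int (f * (t ^ 3 - 9 * t) - 3 * (2 * e - f) * (t ^ 2 - 1)) * Eis 1 2"
      by (rule dvd_mult2) (use t in \<open>simp only: of_nat_dvd_eis_iff of_int_eisenstein eisenstein.sel dvd_0_right\<close>)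
    moreover have "\<not> int q dvd 2 * (t ^ 3 - 9 * t)"
    proof
      assume "int q dvd 2 * (t ^ 3 - 9 * t)"
      then have "int q dvd t ^ 3 - 9 * t" using two q_dvd_mult_iff by blast
      moreover have "- 8 = t * (t ^ 3 - 9 * t) - (t ^ 2 - 8) * (t ^ 2 - 1)"
        by (simp add: power2_eq_square power3_eq_cube algebra_simps)
      ultimately have "int q dvd - 8" using True by (metis dvd_diff dvd_mult)
      then have "int q dvd 2 ^ 3" by simp
      then show False using two q_dvd_power by blast
    qed
    ultimately show ?thesis using main by metis
  qed
qed

lemma residue_criterion_1:
  assumes "q = 3 * m + 1" "\<not> int q dvd eis_norm z"
  shows "of_nat q dvd (z * of_int (eis_norm z)) ^ m - 1 \<longleftrightarrow> int q dvd coord_omega (z ^ m)"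
proof -
  have "of_nat q dvd (z * of_int (eis_norm z)) ^ m - 1 \<longleftrightarrow>
      of_nat q dvd (z * of_int (eis_norm z)) ^ m - z ^ (3 * m)"
    using power_3m_1[OF assms(2,1)] by (meson dvd_diff_sym dvd_diff_trans)
  also have "(z * of_int (eis_norm z)) ^ m - z ^ (3 * m) = z ^ (2 * m) * - (z ^ m - eis_cnj (z ^ m))"
  proof -
    have "(z * of_int (eis_norm z)) ^ m = z ^ (2 * m) * eis_cnj (z ^ m)"
      unfolding mult_eis_cnj[symmetric] eis_cnj_power
      by (simp add: power_mult power_mult_distrib power2_eq_square mult_ac)
    moreover have "z ^ (3 * m) = z ^ (2 * m) * z ^ m" by (simp flip: power_add)
    ultimately show ?thesis by (simp only: mult_minus_right right_diff_distrib minus_diff_eq)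
  qed
  finally show ?thesis unfolding cancel_power[OF assms(2)] dvd_minus_iff real_iff .
qed

lemma residue_criterion_2:
  assumes "q + 1 = 3 * m" "m = Suc n" "\<not> int q dvd eis_norm z"
  shows "of_nat q dvd (z * of_int (eis_norm z)) ^ n * z - 1 \<longleftrightarrow> int q dvd coord_omega (z ^ m)"
proof -
  let ?x = "(z * of_int (eis_norm z)) ^ n * z"
  have x: "eis_cnj z * ?x = z ^ (2 * n + 1) * eis_cnj (z ^ m)"
    unfolding mult_eis_cnj[symmetric] eis_cnj_power assms(2)
    by (simp add: power_mult power_mult_distrib power2_eq_square mult_ac)
  have zq: "z ^ q = z ^ (2 * n + 1) * z ^ m"
  proof -
    have "q = 2 * n + 1 + m" using assms(1,2) by simp
    then show ?thesis by (simp only: power_add)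
  qed
  have "of_nat q dvd ?x - 1 \<longleftrightarrow> of_nat q dvd eis_cnj z ^ 1 * (?x - 1)"
    by (rule cancel_power[symmetric]) (simp add: eis_norm_cnj assms(3))
  also have "eis_cnj z ^ 1 * (?x - 1) = eis_cnj z * ?x - eis_cnj z" by (simp add: algebra_simps)
  also have "of_nat q dvd eis_cnj z * ?x - eis_cnj z \<longleftrightarrow> of_nat q dvd eis_cnj z * ?x - z ^ q"
    using power_q(2)[OF assms(1), of z] by (meson dvd_diff_sym dvd_diff_trans)
  also have "eis_cnj z * ?x - z ^ q = z ^ (2 * n + 1) * - (z ^ m - eis_cnj (z ^ m))"
    unfolding x zq by (simp only: mult_minus_right right_diff_distrib minus_diff_eq)
  finally show ?thesis unfolding cancel_power[OF assms(3)] dvd_minus_iff real_iff .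
qed

end

section \<open>The slope criterion\<close>

lemma slope_cong_g_iff:
  assumes "prime q" "q \<ge> 5" "2 * a = L + 3 * M" "Eis a (3 * M) * \<gamma> = Eis e f"
  shows "slope_cong_g q \<gamma> t L M \<longleftrightarrow>
    [f * (t ^ 3 - 9 * t) = 3 * (2 * e - f) * (t ^ 2 - 1)] (mod int q)"
proof -
  obtain c d where \<gamma>: "\<gamma> = Eis c d" by (cases \<gamma>)
  have L: "L = 2 * a - 3 * M" using assms(3) by simp
  have ef: "e = a * c - 3 * M * d" "f = a * d + 3 * M * c - 3 * M * d"
    using assms(4) by (simp_all add: \<gamma> eis_simps)
  have "g_num \<gamma> t * L - (- g_den \<gamma> t * M)
      = 2 * (f * (t ^ 3 - 9 * t) - 3 * (2 * e - f) * (t ^ 2 - 1))"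
    by (simp add: g_num_def g_den_def Let_def \<gamma> L ef algebra_simps)
  moreover have "\<not> int q dvd 2" using assms(2) by (auto dest: zdvd_imp_le)
  moreover have "prime (int q)" using assms(1) by simp
  ultimately show ?thesis
    unfolding slope_cong_g_def cong_iff_dvd_diff by (metis prime_dvd_mult_iff)
qed

lemma rational_modulus_exists:
  assumes "prime q" "q \<ge> 5"
  obtains m where "rational_modulus q m"
proof -
  have "\<not> 3 dvd q" using assms primes_dvd_imp_eq[of 3 q] by auto
  then have "\<exists>m. q = 3 * m + 1 \<or> q + 1 = 3 * m" by presburger
  then show ?thesis using that assms by (auto simp: rational_modulus_def)
qed

lemma residue_product_eq_1_iff:
  assumes "cubic_prime p \<pi>" "cubic_prime l \<gamma>" "rational_modulus q m" "q \<noteq> p" "q \<noteq> l"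
  shows "cubic_prime.\<chi> \<pi> (int q) * cubic_prime.\<chi> \<gamma> (int q) = 1 \<longleftrightarrow>
    int q dvd coord_omega ((\<pi> * \<gamma>) ^ m)"
proof -
  interpret P: cubic_prime p \<pi> by fact
  interpret Q: cubic_prime l \<gamma> by fact
  interpret rational_modulus q m by fact
  let ?w = "P.\<chi> (int q) * Q.\<chi> (int q)"
  have norm: "eis_norm (\<pi> * \<gamma>) = int p * int l"
    by (simp add: eis_norm_mult P.norm_pi Q.norm_pi)
  have norm': "of_int (eis_norm (\<pi> * \<gamma>)) = (of_nat p * of_nat l :: eisenstein)"
    by (simp add: norm)
  have nd: "\<not> int q dvd eis_norm (\<pi> * \<gamma>)"
    using prime_q P.prime_p Q.prime_p assms(4,5)
    by (auto simp: norm q_dvd_mult_iff dest: primes_dvd_imp_eq)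
  have w: "?w \<in> cube_units"
    by (intro cube_units_mult P.chi_cases Q.chi_cases P.not_dvd_other_prime Q.not_dvd_other_prime
        prime_q assms(4,5))
  have one: "1 \<in> cube_units" by (simp add: cube_units_def)
  have n3: "\<not> eis_norm (of_nat q) dvd 3"
  proof
    assume "eis_norm (of_nat q) dvd 3"
    then have "int q * int q dvd 3" using eis_norm_of_int[of "int q"] by (simp add: power2_eq_square)
    then have "int q dvd 3" by (rule dvd_mult_left)
    then show False using q_dvd_small[of 3] by simp
  qed
  have eq: "v = 1 \<longleftrightarrow> of_nat q dvd x - 1" if "v \<in> cube_units" "of_nat q dvd x - v" for v x
    using that one dvd_cube_units_imp_eq[OF n3] by (metis dvd_diff_sym dvd_diff_trans)
  show ?thesis using q_cases
  proof
    assume q: "q = 3 * m + 1"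
    have "of_nat q dvd (\<pi> * of_nat p) ^ m * (\<gamma> * of_nat l) ^ m
        - eis_cnj (P.\<chi> (int q)) * eis_cnj (Q.\<chi> (int q))"
      by (intro dvd_diff_mult P.reciprocity_1 Q.reciprocity_1 prime_q assms(4,5) q)
    also have "(\<pi> * of_nat p) ^ m * (\<gamma> * of_nat l) ^ m = (\<pi> * \<gamma> * of_int (eis_norm (\<pi> * \<gamma>))) ^ m"
      unfolding norm' by (simp only: power_mult_distrib mult_ac)
    finally have "of_nat q dvd (\<pi> * \<gamma> * of_int (eis_norm (\<pi> * \<gamma>))) ^ m - eis_cnj ?w"
      by (simp only: eis_cnj_mult)
    from eq[OF cube_units_cnj[OF w] this] have "eis_cnj ?w = 1 \<longleftrightarrow> int q dvd coord_omega ((\<pi> * \<gamma>) ^ m)"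
      by (simp only: residue_criterion_1[OF q nd])
    moreover have "eis_cnj ?w = 1 \<longleftrightarrow> ?w = 1" by (metis eis_cnj_1 eis_cnj_cnj)
    ultimately show ?thesis by blast
  next
    assume q: "q + 1 = 3 * m"
    then obtain k where k: "m = Suc k" using m_bounds(1) by (cases m) auto
    have q2: "q = 3 * k + 2" "q \<noteq> 2" using q k q_ge by auto
    have "of_nat q dvd ((\<pi> * of_nat p) ^ k * \<pi>) * ((\<gamma> * of_nat l) ^ k * \<gamma>) - ?w"
      by (intro dvd_diff_mult P.reciprocity_2 Q.reciprocity_2 prime_q assms(4,5) q2)
    also have "((\<pi> * of_nat p) ^ k * \<pi>) * ((\<gamma> * of_nat l) ^ k * \<gamma>)
        = (\<pi> * \<gamma> * of_int (eis_norm (\<pi> * \<gamma>))) ^ k * (\<pi> * \<gamma>)"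
      unfolding norm' by (simp only: power_mult_distrib mult_ac)
    finally show ?thesis
      using eq[OF w] residue_criterion_2[OF q k nd] by blast
  qed
qed

theorem theorem8:
  fixes l :: nat and \<gamma> :: eisenstein
  assumes "prime l" and "[l = 1] (mod 3)"
    and "primary_prime \<gamma>" and "primary_prime (eis_cnj \<gamma>)"
    and "\<gamma> * eis_cnj \<gamma> = of_nat l"
  shows "\<exists>\<epsilon> :: int \<Rightarrow> eisenstein.
    \<epsilon> \<in> Units (residue_ring (int l)) \<rightarrow> {1, eis_omega, eis_cnj eis_omega} \<and>
    (\<forall>(q::nat) (p::nat) (L::int) (M::int).
       prime q \<and> q \<ge> 5 \<and> q \<noteq> l \<and> prime p \<and> [p = 1] (mod 3) \<and> p \<noteq> q \<and>
       4 * int p = L ^ 2 + 27 * M ^ 2 \<longrightarrow>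
       (F q L M = \<epsilon> (int q mod int l) \<longleftrightarrow> (\<exists>t::int. slope_cong_g q \<gamma> t L M)))"
proof -
  have "cubic_prime l \<gamma>"
    using assms by (simp add: cubic_prime_def primary_prime_def eis_norm_def of_nat_eisenstein cong_def)
  then interpret Q: cubic_prime l \<gamma> .
  interpret R: residues "int l" "residue_ring (int l)"
    using Q.p_ge by unfold_locales simp_all
  show ?thesis
  proof (intro exI[of _ Q.chi_cnj] conjI allI impI)
    show "Q.chi_cnj \<in> Units (residue_ring (int l)) \<rightarrow> {1, eis_omega, eis_cnj eis_omega}"
    proof
      fix x assume "x \<in> Units (residue_ring (int l))"
      then have "\<not> int l dvd x" unfolding R.res_units_eq by (auto dest: zdvd_imp_le)
      then show "Q.chi_cnj x \<in> {1, eis_omega, eis_cnj eis_omega}"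
        using Q.chi_cases cube_units_cnj unfolding cube_units_def[symmetric] Q.chi_cnj_def by blast
    qed
  next
    fix q p :: nat and L M :: int
    assume H: "prime q \<and> q \<ge> 5 \<and> q \<noteq> l \<and> prime p \<and> [p = 1] (mod 3) \<and> p \<noteq> q \<and>
       4 * int p = L ^ 2 + 27 * M ^ 2"
    define a where "a = (L + 3 * M) div 2"
    have "even (L ^ 2 + 27 * M ^ 2)" using H by (metis dvd_mult2 even_numeral)
    then have "even (L + 3 * M)" by simp
    then have a: "2 * a = L + 3 * M" by (simp add: a_def)
    then have L: "L = 2 * a - 3 * M" by simp
    have "4 * eis_norm (Eis a (3 * M)) = 4 * int p"
      using H by (simp add: L eis_norm_eq power2_eq_square algebra_simps)
    then have "cubic_prime p (Eis a (3 * M))" using H by (simp add: cubic_prime_def cong_def)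
    then interpret P: cubic_prime p "Eis a (3 * M)" .
    obtain m where m: "rational_modulus q m" using H rational_modulus_exists by blast
    then interpret rational_modulus q m .
    obtain e f where ef: "Eis a (3 * M) * \<gamma> = Eis e f" by (cases "Eis a (3 * M) * \<gamma>")
    have nd: "\<not> int q dvd eis_norm (Eis e f)"
      using H Q.prime_p unfolding ef[symmetric] eis_norm_mult P.norm_pi Q.norm_pi q_dvd_mult_iff
      by (auto dest: primes_dvd_imp_eq)
    have "F q L M = P.\<chi> (int q)" by (simp add: F_def P.\<chi>_def flip: a_def)
    moreover have "Q.chi_cnj (int q mod int l) = Q.chi_cnj (int q)" by (rule periodic_mod[OF Q.periodic_chi_cnj])
    moreover have "\<not> int l dvd int q" using H Q.not_dvd_other_prime by blast
    then have "Q.\<chi> (int q) * Q.chi_cnj (int q) = 1" using Q.chi_mult_cnj by (simp add: Q.chi_cnj_def)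
    then have "P.\<chi> (int q) = Q.chi_cnj (int q) \<longleftrightarrow> P.\<chi> (int q) * Q.\<chi> (int q) = 1"
      by (metis mult.assoc mult.commute mult_1)
    moreover have "P.\<chi> (int q) * Q.\<chi> (int q) = 1 \<longleftrightarrow> int q dvd coord_omega (Eis e f ^ m)"
      unfolding ef[symmetric] using H
      by (intro residue_product_eq_1_iff[OF P.cubic_prime_axioms Q.cubic_prime_axioms m]) auto
    ultimately show "F q L M = Q.chi_cnj (int q mod int l) \<longleftrightarrow> (\<exists>t. slope_cong_g q \<gamma> t L M)"
      using cube_criterion[OF nd] slope_cong_g_iff[OF prime_q q_ge a ef] by simp
  qed
qed

end
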